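(* Let $F:\mathbb{R}^m\to\mathcal{P}(\mathbb{R}^n)$ be an inner semi-continuous definable multifunction with compact values. For $a\in\mathrm{dom}\,F$ there exists a definable $\varphi\in\Phi_p$ such that $$\mathrm{dist}_H(F(x),F(a))\ge\varphi\big(d(x,F^*(F(a)))\big),\qquad x\in K,$$ where $K$ is a compact neighbourhood of $a$ such that $K\subset\mathrm{dom}\,F$, and $F^*(F(a))=\{x\in\mathrm{dom}\,F: F(x)\subset F(a)\}$ is the lower preimage.
   Context: Definable means definable in some o-minimal structure on the real field $(\mathbb{R},+,\cdot)$. A multifunction is a map $F:\mathbb{R}^m\to\mathcal{P}(\mathbb{R}^n)$; its domain is $\mathrm{dom}\,F=\{x: F(x)\ne\emptyset\}$, and it is definable if its graph $\{(x,y)\in\mathbb{R}^m\times\mathbb{R}^n: y\in F(x)\}$ is a definable set. For $b\in\overline{\mathrm{dom}\,F\setminus\{b\}}$, the Kuratowski lower limit $\liminf_{x\to b}F(x)$ is the set of $y$ such that for every sequence $x_\nu\in\mathrm{dom}\,F\setminus\{b\}$ with $x_\nu\to b$ there are $y_\nu\in F(x_\nu)$ with $y_\nu\to y$. $F$ is inner semi-continuous at $b\in\mathrm{dom}\,F$ when $\liminf_{x\to b}F(x)\supset F(b)$, and inner semi-continuous when this holds at the points $b$ of $\mathrm{dom}\,F$. $d(x,S)$ is the Euclidean distance from $x$ to $S$. For non-empty compact sets $A,B$, $\mathrm{dist}_H(A,B)=\max\{\max_{x\in A}d(x,B),\max_{x\in B}d(x,A)\}$. $p\ge1$ is any integer fixed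 a priori, and $\Phi_p$ is the set of all odd, increasing bijections $\phi:\mathbb{R}\to\mathbb{R}$ of class $\mathcal{C}^p$ with $\phi^{(k)}(0)=0$ for $k\in\{1,\dots,p\}$.
   Formalization: The compact neighbourhood K is additionally required to be definable in the same fixed o-minimal structure as F and φ (for arbitrary K the claim can fail); φ may depend on K. *)

theory Defs
  imports "HOL-Analysis.Analysis"
begin

text \<open>A point of the \<open>n\<close>-th Cartesian power of the real line is a list of length \<open>n\<close>, so that one
  object can range over all dimensions at once; \<open>S n\<close> is the family of definable subsets of that power.
  The clauses are those of van den Dries and Miller for an o-minimal structure on the real field.
  Since \<open>tame\<close> puts every singleton into \<open>S 1\<close>, definability is always with real parameters, and
  all real algebraic sets are definable. In \<open>tame\<close>, \<^const>\<open>is_interval\<close> admits bounded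
  and unbounded, open, closed and half-open intervals as well as points.\<close>

locale o_minimal_structure =
  fixes S :: "nat \<Rightarrow> real list set set"
  assumes dimension: "\<And>n A xs. A \<in> S n \<Longrightarrow> xs \<in> A \<Longrightarrow> length xs = n"
    and empty: "\<And>n. {} \<in> S n"
    and union: "\<And>n A B. A \<in> S n \<Longrightarrow> B \<in> S n \<Longrightarrow> A \<union> B \<in> S n"
    and complement: "\<And>n A. A \<in> S n \<Longrightarrow> {xs. length xs = n} - A \<in> S n"
    and cylinder_left: "\<And>n A. A \<in> S n \<Longrightarrow> {t # xs | t xs. xs \<in> A} \<in> S (Suc n)"
    and cylinder_right: "\<And>n A. A \<in> S n \<Longrightarrow> {xs @ [t] | t xs. xs \<in> A} \<in> S (Suc n)"
    and diagonal: "\<And>n. n > 0 \<Longrightarrow> {xs. length xs = n \<and> hd xs = last xs} \<in> S n"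
    and projection: "\<And>n A. A \<in> S (Suc n) \<Longrightarrow> butlast ` A \<in> S n"
    and addition: "{[x, y, x + y] | x y. True} \<in> S 3"
    and multiplication: "{[x, y, x * y] | x y. True} \<in> S 3"
    and tame: "S 1 = {(\<lambda>t. [t]) ` (\<Union>\<I>) | \<I>. finite \<I> \<and> (\<forall>I\<in>\<I>. is_interval I)}"

text \<open>The coordinates of a vector with respect to the standard basis, taken in a fixed but arbitrary
  order. As every \<open>S n\<close> is invariant under permutations of the coordinates, the notion of
  definability below does not depend on that order. It applies to all of
  \<open>real ^ 'n\<close>, \<open>real\<close> and their products, hence also to graphs as sets of pairs.\<close>

definition basis_list :: "'a::euclidean_space list" where
  "basis_list = (SOME bs. distinct bs \<and> set bs = Basis)"

definition coords :: "'a::euclidean_space \<Rightarrow> real list" where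
  "coords x = map (\<lambda>b. x \<bullet> b) basis_list"

definition definable :: "(nat \<Rightarrow> real list set set) \<Rightarrow> 'a::euclidean_space set \<Rightarrow> bool" where
  "definable S A \<longleftrightarrow> coords ` A \<in> S DIM('a)"

definition definable_fun ::
  "(nat \<Rightarrow> real list set set) \<Rightarrow> ('a::euclidean_space \<Rightarrow> 'b::euclidean_space) \<Rightarrow> bool" where
  "definable_fun S f \<longleftrightarrow> definable S {(x, y). y = f x}"

definition definable_multifunction ::
  "(nat \<Rightarrow> real list set set) \<Rightarrow> ('a::euclidean_space \<Rightarrow> 'b::euclidean_space set) \<Rightarrow> bool" where
  "definable_multifunction S F \<longleftrightarrow> definable S {(x, y). y \<in> F x}"

definition mdom :: "('a \<Rightarrow> 'b set) \<Rightarrow> 'a set" where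
  "mdom F = {x. F x \<noteq> {}}"

definition lower_preimage :: "('a \<Rightarrow> 'b set) \<Rightarrow> 'b set \<Rightarrow> 'a set" where
  "lower_preimage F B = {x \<in> mdom F. F x \<subseteq> B}"

text \<open>At an isolated point \<open>b\<close> of the domain no sequence qualifies, the lower limit is everything
  and inner semi-continuity at \<open>b\<close> imposes no condition.\<close>

definition lower_limit ::
  "('a::topological_space \<Rightarrow> 'b::topological_space set) \<Rightarrow> 'a \<Rightarrow> 'b set" where
  "lower_limit F b = {y. \<forall>x :: nat \<Rightarrow> 'a. (\<forall>\<nu>. x \<nu> \<in> mdom F - {b}) \<longrightarrow> x \<longlonglongrightarrow> b \<longrightarrow>
     (\<exists>z. (\<forall>\<nu>. z \<nu> \<in> F (x \<nu>)) \<and> z \<longlonglongrightarrow> y)}"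

definition inner_semicontinuous ::
  "('a::topological_space \<Rightarrow> 'b::topological_space set) \<Rightarrow> bool" where
  "inner_semicontinuous F \<longleftrightarrow> (\<forall>b\<in>mdom F. F b \<subseteq> lower_limit F b)"

text \<open>Intended for non-empty compact sets, where both suprema are attained maxima.\<close>

definition hausdorff_dist :: "'a::metric_space set \<Rightarrow> 'a set \<Rightarrow> real" where
  "hausdorff_dist A B = max (SUP x\<in>A. infdist x B) (SUP x\<in>B. infdist x A)"

definition class_C :: "nat \<Rightarrow> (real \<Rightarrow> real) \<Rightarrow> bool" where
  "class_C p f \<longleftrightarrow> (\<forall>k<p. (deriv ^^ k) f differentiable_on UNIV) \<and>
     continuous_on UNIV ((deriv ^^ p) f)"

definition Phi :: "nat \<Rightarrow> (real \<Rightarrow> real) set" where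
  "Phi p = {\<phi>. (\<forall>t. \<phi> (- t) = - \<phi> t) \<and> strict_mono \<phi> \<and> bij \<phi> \<and> class_C p \<phi> \<and>
     (\<forall>k\<in>{1..p}. (deriv ^^ k) \<phi> 0 = 0)}"

end

theory Submission
  imports Defs
begin

text \<open>Let \<open>m t\<close> be the infimum of the excess of \<open>F x\<close> over \<open>F a\<close>, cut off at \<open>1\<close>, over the points
  \<open>x \<in> K\<close> at distance at least \<open>t\<close> from the lower preimage. It is definable and nondecreasing, and
  inner semi-continuity (which makes the excess lower semi-continuous) with compactness of \<open>K\<close> makes
  it positive for \<open>t > 0\<close>. It remains to find a minorant of \<open>m\<close> in \<open>\<Phi>\<^sub>p\<close>.

  A definable function of one variable is differentiable near \<open>0+\<close>: by o-minimality
  its one-sided derivatives exist in the extended reals, they agree off a countable set, and the common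
  value cannot be infinite on an interval. Hence the derivatives of all orders exist near \<open>0+\<close> and have
  limits there. If \<open>u\<close> tends to \<open>0\<close> then so does \<open>t\<^sup>2 * u'\<close>, so each differentiation of
  \<open>t ^ N * u t\<close> costs only two powers of \<open>t\<close>; thus \<open>t ^ N * (t * m t)\<close> is flat at \<open>0\<close>
  for large \<open>N\<close>.\<close>

section \<open>Closure properties of definable sets\<close>

context o_minimal_structure
begin

lemma full_space: "{xs. length xs = n} \<in> S n"
  using complement[OF empty] by simp

lemma intersection:
  assumes "A \<in> S n" "B \<in> S n"
  shows "A \<inter> B \<in> S n"
proof -
  let ?X = "{xs :: real list. length xs = n}"
  have "A \<inter> B = ?X - ((?X - A) \<union> (?X - B))"
    using dimension[OF assms(1)] dimension[OF assms(2)] by auto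
  thus ?thesis using assms by (simp only:) (intro complement union)
qed

lemma prepend_coordinates:
  assumes "A \<in> S k"
  shows "{xs @ ys | xs ys. length xs = n \<and> ys \<in> A} \<in> S (n + k)"
proof (induction n)
  case 0
  show ?case using assms by simp
next
  case (Suc n)
  have "{xs @ ys | xs ys. length xs = Suc n \<and> ys \<in> A} =
      {t # zs | t zs. zs \<in> {xs @ ys | xs ys. length xs = n \<and> ys \<in> A}}"
  proof safe
    fix xs ys :: "real list" assume "length xs = Suc n" "ys \<in> A"
    then show "\<exists>t zs. xs @ ys = t # zs \<and> zs \<in> {xs @ ys |xs ys. length xs = n \<and> ys \<in> A}"
      by (cases xs) auto
  next
    fix t and xs ys :: "real list" assume "ys \<in> A" "n = length xs"
    then show "\<exists>xsa ysa. t # xs @ ys = xsa @ ysa \<and> length xsa = Suc (length xs) \<and> ysa \<in> A"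
      by (intro exI[of _ "t # xs"] exI[of _ ys]) simp
  qed
  thus ?case using cylinder_left[OF Suc] by simp
qed

lemma append_coordinates:
  assumes "A \<in> S k"
  shows "{xs @ ys | xs ys. xs \<in> A \<and> length ys = n} \<in> S (k + n)"
proof (induction n)
  case 0
  show ?case using assms by simp
next
  case (Suc n)
  have "{xs @ ys | xs ys. xs \<in> A \<and> length ys = Suc n} =
      {zs @ [t] | t zs. zs \<in> {xs @ ys | xs ys. xs \<in> A \<and> length ys = n}}"
  proof safe
    fix xs ys :: "real list" assume "length ys = Suc n" "xs \<in> A"
    then show "\<exists>t zs. xs @ ys = zs @ [t] \<and> zs \<in> {xs @ ys |xs ys. xs \<in> A \<and> length ys = n}"
      by (cases ys rule: rev_cases) auto
  next
    fix t and xs ys :: "real list" assume "xs \<in> A" "n = length ys"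
    then show "\<exists>xsa ysa. (xs @ ys) @ [t] = xsa @ ysa \<and> xsa \<in> A \<and> length ysa = Suc (length ys)"
      by (intro exI[of _ xs] exI[of _ "ys @ [t]"]) simp
  qed
  thus ?case using cylinder_right[OF Suc] by simp
qed

lemma take_image:
  assumes "A \<in> S (n + k)"
  shows "take n ` A \<in> S n"
  using assms
proof (induction k arbitrary: A)
  case 0
  have "take n ` A = A" using dimension[OF 0] by (force simp: image_iff)
  thus ?case using 0 by simp
next
  case (Suc k)
  have "take n ` butlast ` A = take n ` A"
    unfolding image_image
    by (intro image_cong refl) (use dimension[OF Suc.prems] in \<open>simp add: butlast_conv_take min_def\<close>)
  thus ?case using Suc.IH[OF projection[of A "n + k"]] Suc.prems by simp
qed

text \<open>Only the equality of the first and last coordinates is an axiom. For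
  \<open>i < j\<close> that diagonal is placed on the block of coordinates from \<open>i\<close> to
  \<open>j\<close>, with free coordinates attached on both sides.\<close>

lemma coordinates_equal:
  assumes "i < n" "j < n"
  shows "{xs. length xs = n \<and> xs ! i = xs ! j} \<in> S n"
proof -
  have *: "{xs. length xs = n \<and> xs ! i = xs ! j} \<in> S n" if "i < j" "j < n" for i j
  proof -
    \<comment> \<open>\<open>l\<close> counts the coordinates from \<open>i\<close> to
      \<open>j\<close> inclusive, \<open>r\<close> those after \<open>j\<close>.\<close>
    define l where "l = Suc (j - i)"
    define r where "r = n - Suc j"
    let ?D = "{xs :: real list. length xs = l \<and> hd xs = last xs}"
    let ?E = "{xs @ ys | xs ys. xs \<in> ?D \<and> length ys = r}"
    have n: "n = i + (l + r)" using that by (simp add: l_def r_def)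
    have "{xs @ ys | xs ys. length xs = i \<and> ys \<in> ?E} \<in> S n"
      unfolding n by (intro prepend_coordinates append_coordinates diagonal) (simp add: l_def)
    moreover have "{xs @ ys | xs ys. length xs = i \<and> ys \<in> ?E} =
        {xs. length xs = n \<and> xs ! i = xs ! j}"
    proof (intro equalityI subsetI)
      fix us assume "us \<in> {xs @ ys | xs ys. length xs = i \<and> ys \<in> ?E}"
      then obtain xs ys zs where us: "us = xs @ ys @ zs" "length xs = i" "length ys = l"
        "hd ys = last ys" "length zs = r" by blast
      have "ys \<noteq> []" using us(3) by (auto simp: l_def)
      thus "us \<in> {xs. length xs = n \<and> xs ! i = xs ! j}"
        using that n us by (auto simp: nth_append hd_conv_nth last_conv_nth l_def)
    next
      fix xs :: "real list" assume xs: "xs \<in> {xs. length xs = n \<and> xs ! i = xs ! j}"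
      have len: "length (take l (drop i xs)) = l" using that xs by (simp add: l_def)
      moreover from this have "last (take l (drop i xs)) = xs ! j"
        using that xs by (subst last_conv_nth) (auto simp: l_def)
      ultimately have D: "take l (drop i xs) \<in> ?D"
        using that xs by (simp add: l_def hd_drop_conv_nth)
      have r: "length (drop l (drop i xs)) = r" "length (take i xs) = i"
        using that xs by (auto simp: r_def l_def)
      have "xs = take i xs @ take l (drop i xs) @ drop l (drop i xs)"
        by (simp only: append_take_drop_id)
      with D r show "xs \<in> {xs @ ys | xs ys. length xs = i \<and> ys \<in> ?E}" by blast
    qed
    ultimately show ?thesis by simp
  qed
  consider "i < j" | "i = j" | "j < i" by linarith
  thus ?thesis
  proof cases
    case 1 thus ?thesis using * assms by simp
  next
    case 2 thus ?thesis using full_space by simp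
  next
    case 3
    have "{xs. length xs = n \<and> xs ! i = xs ! j} = {xs. length xs = n \<and> xs ! j = xs ! i}" by auto
    thus ?thesis using *[OF 3 assms(1)] by metis
  qed
qed

text \<open>All permutations, repetitions and omissions of coordinates are obtained at once: a block
  lying in \<open>A\<close> is appended, each of its entries is equated with the coordinate named by
  \<open>idx\<close>, and the block is projected away.\<close>

lemma reindex:
  assumes "A \<in> S (length idx)" and "\<forall>i\<in>set idx. i < n"
  shows "{xs. length xs = n \<and> map (nth xs) idx \<in> A} \<in> S n"
proof -
  let ?k = "length idx"
  have E: "{zs. length zs = n + ?k \<and> (\<forall>j<l. zs ! (n + j) = zs ! (idx ! j))} \<in> S (n + ?k)"
    if "l \<le> ?k" for l
    using that
  proof (induction l)
    case 0
    show ?case using full_space by simp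
  next
    case (Suc l)
    have "idx ! l < n" using Suc.prems assms(2) by simp
    hence "{zs. length zs = n + ?k \<and> (\<forall>j<l. zs ! (n + j) = zs ! (idx ! j))} \<inter>
        {zs. length zs = n + ?k \<and> zs ! (n + l) = zs ! (idx ! l)} \<in> S (n + ?k)" (is "?C \<in> _")
      using Suc by (intro intersection coordinates_equal) auto
    moreover have "?C = {zs. length zs = n + ?k \<and> (\<forall>j<Suc l. zs ! (n + j) = zs ! (idx ! j))}"
      by (auto simp: less_Suc_eq)
    ultimately show ?case by simp
  qed
  let ?B = "{xs @ ys | xs ys. length xs = n \<and> ys \<in> A} \<inter>
    {zs. length zs = n + ?k \<and> (\<forall>j<?k. zs ! (n + j) = zs ! (idx ! j))}"
  have "take n ` ?B \<in> S n"
    by (rule take_image[OF intersection[OF prepend_coordinates[OF assms(1)] E[OF order_refl]]])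
  moreover have "take n ` ?B = {xs. length xs = n \<and> map (nth xs) idx \<in> A}"
  proof safe
    fix xs ys :: "real list"
    assume *: "\<forall>j<?k. (xs @ ys) ! (length xs + j) = (xs @ ys) ! (idx ! j)"
      "n = length xs" "ys \<in> A"
    have "map (nth xs) idx = ys"
      using * assms(2) dimension[OF assms(1) *(3)]
      by (intro nth_equalityI) (auto simp: nth_append)
    thus "map (nth (take (length xs) (xs @ ys))) idx \<in> A" using * by simp
  next
    fix xs :: "real list" assume *: "n = length xs" "map (nth xs) idx \<in> A"
    show "xs \<in> take (length xs) ` ({xsa @ ys | xsa ys. length xsa = length xs \<and> ys \<in> A} \<inter>
        {zs. length zs = length xs + ?k \<and> (\<forall>j<?k. zs ! (length xs + j) = zs ! (idx ! j))})"
      using * assms(2)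
      by (intro image_eqI[of _ _ "xs @ map (nth xs) idx"]) (auto simp: nth_append)
  qed (auto)
  ultimately show ?thesis by simp
qed

end

section \<open>Coordinates of Euclidean spaces\<close>

lemma basis_list: "distinct (basis_list :: 'a::euclidean_space list)"
    "set (basis_list :: 'a list) = Basis"
proof -
  have "\<exists>bs. distinct bs \<and> set bs = (Basis :: 'a set)"
    using finite_distinct_list[OF finite_Basis] by blast
  from someI_ex[OF this] show "distinct (basis_list :: 'a list)" "set (basis_list :: 'a list) = Basis"
    unfolding basis_list_def by auto
qed

lemma length_basis_list [simp]: "length (basis_list :: 'a::euclidean_space list) = DIM('a)"
proof -
  have "distinct (basis_list :: 'a list)" by (rule basis_list)
  from distinct_card[OF this] show ?thesis by (simp add: basis_list(2))
qed

lemma length_coords [simp]: "length (coords (x :: 'a::euclidean_space)) = DIM('a)"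
  by (simp add: coords_def)

lemma coords_eq_iff [simp]: "coords x = coords y \<longleftrightarrow> x = (y :: 'a::euclidean_space)"
  by (auto simp: coords_def basis_list(2) intro: euclidean_eqI)

lemma coords_surj:
  assumes "length xs = DIM('a::euclidean_space)"
  obtains x :: "'a::euclidean_space" where "coords x = xs"
proof
  let ?bl = "basis_list :: 'a list"
  have *: "?bl ! j \<bullet> ?bl ! i = (if j = i then 1 else 0)" if "i < DIM('a)" "j < DIM('a)" for i j
    using that basis_list[where ?'a='a] nth_mem[of i ?bl] nth_mem[of j ?bl]
    by (auto simp: inner_Basis nth_eq_iff_index_eq)
  show "coords (\<Sum>j<DIM('a). xs ! j *\<^sub>R ?bl ! j) = xs"
    using assms
    by (intro nth_equalityI) (simp_all add: coords_def inner_sum_left * if_distrib cong: if_cong)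
qed

lemma select_indices:
  assumes "set bs \<subseteq> set cs"
  obtains idx where "length idx = length bs" "\<forall>i\<in>set idx. i < length cs" "bs = map (nth cs) idx"
proof -
  have "\<forall>b\<in>set bs. \<exists>i<length cs. cs ! i = b" using assms by (meson in_set_conv_nth subsetD)
  then obtain f where "\<forall>b\<in>set bs. f b < length cs \<and> cs ! f b = b" by metis
  thus ?thesis by (intro that[of "map f bs"]) (auto simp: map_idI)
qed

section \<open>Definable predicates and functions\<close>

context o_minimal_structure
begin

text \<open>Predicates replace sets so that definability can be proved by recursion on a first-order
  formula, with one rule for each connective, quantifier and operation.\<close>

definition dpred :: "('a::euclidean_space \<Rightarrow> bool) \<Rightarrow> bool" where
  "dpred P \<longleftrightarrow> definable S {x. P x}"

definition dfun :: "('a::euclidean_space \<Rightarrow> 'b::euclidean_space) \<Rightarrow> bool" where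
  "dfun f \<longleftrightarrow> dpred (\<lambda>z. snd z = f (fst z))"

lemma dfun_iff: "dfun f \<longleftrightarrow> definable_fun S f"
  by (simp add: dfun_def dpred_def definable_fun_def case_prod_unfold)

text \<open>The bridge from lists to vectors: \<open>bs\<close> may list basis vectors in any order
  and with repetitions, and \<open>reindex\<close> reconciles it with the arbitrary order of
  \<open>basis_list\<close>.\<close>

lemma dpred_coordinates:
  fixes bs :: "'a::euclidean_space list"
  assumes "A \<in> S (length bs)" "set bs \<subseteq> Basis"
  shows "dpred (\<lambda>x. map (\<lambda>b. x \<bullet> b) bs \<in> A)"
proof -
  obtain idx where idx: "length idx = length bs" "\<forall>i\<in>set idx. i < DIM('a)"
    "bs = map (nth basis_list) idx"
    using select_indices[of bs "basis_list :: 'a list"] assms(2) by (auto simp: basis_list)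
  have c: "map (nth (coords x)) idx = map (\<lambda>b. x \<bullet> b) bs" for x
    using idx(2) by (simp add: idx(3) coords_def)
  have "coords ` {x. map (\<lambda>b. x \<bullet> b) bs \<in> A} =
      {xs. length xs = DIM('a) \<and> map (nth xs) idx \<in> A}"
  proof (intro set_eqI iffI; clarsimp simp: c)
    fix xs :: "real list" assume "length xs = DIM('a)" "map (nth xs) idx \<in> A"
    then show "xs \<in> coords ` {x. map (\<lambda>b. x \<bullet> b) bs \<in> A}"
      using c by (metis (mono_tags, lifting) coords_surj image_eqI mem_Collect_eq)
  qed
  thus ?thesis using reindex[of A idx "DIM('a)"] idx(1,2) assms(1) by (simp add: dpred_def definable_def)
qed

text \<open>A quantifier is a projection, but \<open>basis_list\<close> of a product may interleave
  the coordinates of the two factors. They are first rearranged by \<open>reindex\<close> so that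
  those of \<open>x\<close> come first; then \<open>take\<close> removes those of
  \<open>y\<close>.\<close>

lemma dpred_ex:
  fixes P :: "'a::euclidean_space \<Rightarrow> 'b::euclidean_space \<Rightarrow> bool"
  assumes "dpred (\<lambda>z. P (fst z) (snd z))"
  shows "dpred (\<lambda>x. \<exists>y. P x y)"
proof -
  let ?bs = "map (\<lambda>b. (b, 0)) basis_list @ map (\<lambda>b. (0, b)) basis_list :: ('a \<times> 'b) list"
  let ?A = "coords ` {z. P (fst z) (snd z)}"
  let ?n = "DIM('a)" and ?k = "DIM('b)"
  have "set (basis_list :: ('a \<times> 'b) list) \<subseteq> set ?bs"
    by (auto simp: basis_list Basis_prod_def)
  from select_indices[OF this] obtain idx where idx: "length idx = ?n + ?k"
    "\<forall>i\<in>set idx. i < ?n + ?k" "basis_list = map (nth ?bs) idx"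
    by auto
  have c: "map (nth (coords x @ coords y)) idx = coords (x, y)" for x :: 'a and y :: 'b
  proof -
    have "coords x @ coords y = map (\<lambda>b. (x, y) \<bullet> b) ?bs" by (simp add: coords_def)
    thus ?thesis using idx(2) by (simp add: coords_def idx(3) del: map_append)
  qed
  have B: "{xs. length xs = ?n + ?k \<and> map (nth xs) idx \<in> ?A} \<in> S (?n + ?k)"
    using assms idx by (intro reindex) (auto simp: dpred_def definable_def)
  have "take ?n ` {xs. length xs = ?n + ?k \<and> map (nth xs) idx \<in> ?A} = coords ` {x. \<exists>y. P x y}"
  proof safe
    fix xs z assume *: "length xs = ?n + ?k" "map (nth xs) idx = coords z" "P (fst z) (snd z)"
    obtain x :: 'a where x: "coords x = take ?n xs" using coords_surj[of "take ?n xs"] * by auto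
    obtain y :: 'b where y: "coords y = drop ?n xs" using coords_surj[of "drop ?n xs"] * by auto
    have "z = (x, y)" using c[of x y] * by (simp add: x y)
    thus "take ?n xs \<in> coords ` {x. \<exists>y. P x y}" using * by (auto simp flip: x)
  next
    fix x y assume "P x y"
    thus "coords x \<in> take ?n ` {xs. length xs = ?n + ?k \<and> map (nth xs) idx \<in> ?A}"
      by (intro image_eqI[of _ _ "coords x @ coords y"]) (auto simp: c)
  qed
  thus ?thesis using take_image[OF B] by (simp add: dpred_def definable_def)
qed

lemma dpred_not: "dpred P \<Longrightarrow> dpred (\<lambda>x. \<not> P x)" for P :: "'a::euclidean_space \<Rightarrow> bool"
proof -
  assume "dpred P"
  moreover have "coords ` {x. \<not> P x} = {xs. length xs = DIM('a)} - coords ` {x. P x}"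
  proof (intro equalityI subsetI)
    fix xs assume *: "xs \<in> {xs. length xs = DIM('a)} - coords ` {x. P x}"
    then obtain x :: 'a where x: "coords x = xs" using coords_surj[of xs] by auto
    with * have "\<not> P x" by auto
    with x show "xs \<in> coords ` {x. \<not> P x}" by auto
  qed auto
  ultimately show ?thesis by (simp add: dpred_def definable_def complement)
qed

lemma dpred_or: "dpred P \<Longrightarrow> dpred Q \<Longrightarrow> dpred (\<lambda>x. P x \<or> Q x)"
  by (simp add: dpred_def definable_def Collect_disj_eq image_Un union)

lemma dpred_and:
  assumes "dpred P" "dpred Q"
  shows "dpred (\<lambda>x. P x \<and> Q x)"
  using dpred_not[OF dpred_or[OF dpred_not[OF assms(1)] dpred_not[OF assms(2)]]] by simp

lemma dpred_imp:
  assumes "dpred P" "dpred Q"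
  shows "dpred (\<lambda>x. P x \<longrightarrow> Q x)"
  using dpred_or[OF dpred_not[OF assms(1)] assms(2)] by (simp only: imp_conv_disj)

lemma dpred_all:
  assumes "dpred (\<lambda>z. P (fst z) (snd z))"
  shows "dpred (\<lambda>x. \<forall>y. P x y)"
proof -
  have "dpred (\<lambda>x. \<not> (\<exists>y. \<not> P x y))"
    by (rule dpred_not, rule dpred_ex, rule dpred_not, rule assms)
  thus ?thesis by (simp only: not_ex not_not)
qed

lemma dpred_const: "dpred (\<lambda>x :: 'a::euclidean_space. c)"
proof -
  have "dpred (\<lambda>x :: 'a. False)" by (simp add: dpred_def definable_def empty)
  thus ?thesis using dpred_not[of "\<lambda>x :: 'a. False"] by (cases c) auto
qed

lemma dpred_finite_all:
  "finite I \<Longrightarrow> (\<And>i. i \<in> I \<Longrightarrow> dpred (P i)) \<Longrightarrow> dpred (\<lambda>x. \<forall>i\<in>I. P i x)"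
  by (induction I rule: finite_induct) (simp_all add: dpred_const dpred_and)

lemma dpred_inner_eq:
  assumes "b \<in> Basis" "c \<in> Basis"
  shows "dpred (\<lambda>z. z \<bullet> b = z \<bullet> c)"
proof -
  have "{xs :: real list. length xs = 2 \<and> hd xs = last xs} \<in> S (length [b, c])"
    using diagonal[of 2] by (simp add: numeral_2_eq_2)
  from dpred_coordinates[OF this] show ?thesis using assms by simp
qed

end

section \<open>Substitution into definable predicates\<close>

named_theorems definability

text \<open>These maps only select, repeat and rearrange coordinates, so substituting them needs
  \<open>reindex\<close> alone. They come first because substitution of a general definable function
  already uses projections and pairings.\<close>

definition coordinate_map :: "('a::euclidean_space \<Rightarrow> 'b::euclidean_space) \<Rightarrow> bool" where
  "coordinate_map g \<longleftrightarrow> (\<forall>c\<in>Basis. \<exists>b\<in>Basis. \<forall>x. g x \<bullet> c = x \<bullet> b)"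

lemma coordinate_map_id: "coordinate_map (\<lambda>x. x)"
  by (auto simp: coordinate_map_def)

lemma coordinate_map_fst:
  fixes g :: "'a::euclidean_space \<Rightarrow> 'b::euclidean_space \<times> 'c::euclidean_space"
  assumes "coordinate_map g"
  shows "coordinate_map (\<lambda>x. fst (g x))"
  unfolding coordinate_map_def
proof
  fix c :: 'b assume "c \<in> Basis"
  hence "(c, 0) \<in> (Basis :: ('b \<times> 'c) set)" by (simp add: Basis_prod_def)
  with assms obtain b where "b \<in> Basis" "\<forall>x. g x \<bullet> (c, 0) = x \<bullet> b"
    unfolding coordinate_map_def by blast
  thus "\<exists>b\<in>Basis. \<forall>x. fst (g x) \<bullet> c = x \<bullet> b" by (auto simp: inner_prod_def)
qed

lemma coordinate_map_snd:
  fixes g :: "'a::euclidean_space \<Rightarrow> 'b::euclidean_space \<times> 'c::euclidean_space"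
  assumes "coordinate_map g"
  shows "coordinate_map (\<lambda>x. snd (g x))"
  unfolding coordinate_map_def
proof
  fix c :: 'c assume "c \<in> Basis"
  hence "(0, c) \<in> (Basis :: ('b \<times> 'c) set)" by (simp add: Basis_prod_def)
  with assms obtain b where "b \<in> Basis" "\<forall>x. g x \<bullet> (0, c) = x \<bullet> b"
    unfolding coordinate_map_def by blast
  thus "\<exists>b\<in>Basis. \<forall>x. snd (g x) \<bullet> c = x \<bullet> b" by (auto simp: inner_prod_def)
qed

lemma coordinate_map_Pair:
  "coordinate_map f \<Longrightarrow> coordinate_map g \<Longrightarrow> coordinate_map (\<lambda>x. (f x, g x))"
  by (auto simp: coordinate_map_def Basis_prod_def)

lemma coordinate_map_inner: "b \<in> Basis \<Longrightarrow> coordinate_map g \<Longrightarrow> coordinate_map (\<lambda>x. g x \<bullet> b)"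
  by (auto simp: coordinate_map_def)

lemmas coordinate_map_intros = coordinate_map_id coordinate_map_fst coordinate_map_snd
  coordinate_map_Pair coordinate_map_inner

context o_minimal_structure
begin

declare dpred_const [definability] dpred_and [definability] dpred_or [definability]
  dpred_not [definability] dpred_imp [definability] dpred_ex [definability] dpred_all [definability]

lemma dpred_coordinate_map:
  fixes g :: "'a::euclidean_space \<Rightarrow> 'b::euclidean_space"
  assumes "dpred P" "coordinate_map g"
  shows "dpred (\<lambda>x. P (g x))"
proof -
  obtain h where h: "\<And>c. c \<in> Basis \<Longrightarrow> h c \<in> Basis \<and> (\<forall>x. g x \<bullet> c = x \<bullet> h c)"
    using assms(2) unfolding coordinate_map_def by metis
  have "dpred (\<lambda>x. map (\<lambda>b. x \<bullet> b) (map h basis_list) \<in> coords ` {y. P y})"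
    using h assms(1) by (intro dpred_coordinates) (auto simp: dpred_def definable_def basis_list)
  moreover have "map (\<lambda>b. x \<bullet> b) (map h basis_list) = coords (g x)" for x
    using h by (auto simp: coords_def basis_list)
  ultimately show ?thesis by (simp add: image_iff)
qed

lemma dfun_coordinate_map:
  fixes g :: "'a::euclidean_space \<Rightarrow> 'b::euclidean_space"
  assumes "coordinate_map g"
  shows "dfun g"
proof -
  obtain h where h: "\<And>c. c \<in> Basis \<Longrightarrow> h c \<in> Basis \<and> (\<forall>x. g x \<bullet> c = x \<bullet> h c)"
    using assms unfolding coordinate_map_def by metis
  have "dpred (\<lambda>z :: 'a \<times> 'b. \<forall>c\<in>Basis. z \<bullet> (0, c) = z \<bullet> (h c, 0))"
    using h by (intro dpred_finite_all dpred_inner_eq) (auto simp: Basis_prod_def)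
  moreover have "(\<forall>c\<in>Basis. z \<bullet> (0, c) = z \<bullet> (h c, 0)) \<longleftrightarrow> snd z = g (fst z)" for z
    using h by (auto simp: inner_prod_def intro: euclidean_eqI)
  ultimately show ?thesis by (simp add: dfun_def)
qed

lemma dfunD:
  assumes "dfun f" "coordinate_map g" "coordinate_map h"
  shows "dpred (\<lambda>x. h x = f (g x))"
  using dpred_coordinate_map[OF assms(1)[unfolded dfun_def] coordinate_map_Pair[OF assms(2,3)]]
  by simp

text \<open>\<open>P (f x)\<close> is rewritten as \<open>\<exists>y. y = f x \<and> P y\<close>, in
  which the only substitutions left are coordinate maps.\<close>

lemma dpred_compose:
  assumes "dpred P" "dfun f"
  shows "dpred (\<lambda>x. P (f x))"
proof -
  have "dpred (\<lambda>x. \<exists>y. y = f x \<and> P y)"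
    by (intro dpred_ex dpred_and dfunD dpred_coordinate_map[OF assms(1)] assms(2)
        coordinate_map_intros)
  thus ?thesis by simp
qed

lemma dfun_compose:
  assumes "dfun f" "dfun g"
  shows "dfun (\<lambda>x. f (g x))"
proof -
  have "dpred (\<lambda>z. \<exists>w. w = g (fst z) \<and> snd z = f w)"
    by (intro dpred_ex dpred_and dfunD assms coordinate_map_intros)
  thus ?thesis by (simp add: dfun_def)
qed

lemma dfun_id [definability]: "dfun (\<lambda>x. x)"
  by (intro dfun_coordinate_map coordinate_map_intros)

lemma dfun_fst [definability]: "dfun f \<Longrightarrow> dfun (\<lambda>x. fst (f x))"
  by (rule dfun_compose[of fst]) (intro dfun_coordinate_map coordinate_map_intros)

lemma dfun_snd [definability]: "dfun f \<Longrightarrow> dfun (\<lambda>x. snd (f x))"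
  by (rule dfun_compose[of snd]) (intro dfun_coordinate_map coordinate_map_intros)

lemma dfun_inner_Basis: "b \<in> Basis \<Longrightarrow> dfun f \<Longrightarrow> dfun (\<lambda>x. f x \<bullet> b)"
  by (rule dfun_compose[of "\<lambda>x. x \<bullet> b"]) (intro dfun_coordinate_map coordinate_map_intros)

lemma dfun_Pair [definability]:
  assumes "dfun f" "dfun g"
  shows "dfun (\<lambda>x. (f x, g x))"
proof -
  have "dpred (\<lambda>z. fst (snd z) = f (fst z) \<and> snd (snd z) = g (fst z))"
    by (intro dpred_and dfunD assms coordinate_map_intros)
  thus ?thesis by (simp add: dfun_def prod_eq_iff)
qed

lemma dpred_compose2:
  assumes "dpred (\<lambda>z. P (fst z) (snd z))" "dfun f" "dfun g"
  shows "dpred (\<lambda>x. P (f x) (g x))"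
  using dpred_compose[OF assms(1) dfun_Pair[OF assms(2,3)]] by simp

lemma dfun_compose2:
  assumes "dfun (\<lambda>z. h (fst z) (snd z))" "dfun f" "dfun g"
  shows "dfun (\<lambda>x. h (f x) (g x))"
  using dfun_compose[OF assms(1) dfun_Pair[OF assms(2,3)]] by simp

lemma dpred_eq [definability]: "dfun f \<Longrightarrow> dfun g \<Longrightarrow> dpred (\<lambda>x. f x = g x)"
  for f :: "'a::euclidean_space \<Rightarrow> 'b::euclidean_space"
proof (erule (1) dpred_compose2[rotated])
  have "dfun (\<lambda>x :: 'b. x)" by (rule dfun_id)
  thus "dpred (\<lambda>z :: 'b \<times> 'b. fst z = snd z)" by (simp add: dfun_def eq_commute)
qed

text \<open>Functions are introduced below through a first-order formula \<open>Q\<close> that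
  determines the value, often implicitly, as for differences, quotients and square roots.\<close>

lemma dfunI:
  assumes "dpred (\<lambda>z. Q (fst z) (snd z))" "\<And>x y. Q x y \<longleftrightarrow> y = f x"
  shows "dfun f"
  using assms by (simp add: dfun_def)

lemma dfun_const [definability]:
  fixes c :: "'b::euclidean_space"
  shows "dfun (\<lambda>x :: 'a::euclidean_space. c)"
proof -
  have "dpred (\<lambda>y :: 'b. \<forall>b\<in>Basis. map (\<lambda>b. y \<bullet> b) [b] \<in> {[c \<bullet> b]})"
  proof (intro dpred_finite_all dpred_coordinates)
    fix b :: 'b
    \<comment> \<open>\<open>tame\<close> supplies the singleton as a union of one degenerate
      interval; this is where parameters enter.\<close>
    have "(\<lambda>t. [t]) ` \<Union>{{c \<bullet> b}} \<in> S 1"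
      unfolding tame by (intro CollectI exI[of _ "{{c \<bullet> b}}"]) (auto simp: is_interval_1)
    thus "{[c \<bullet> b]} \<in> S (length [b])" by simp
  qed auto
  hence "dpred (\<lambda>y :: 'b. y = c)" by (simp flip: euclidean_eq_iff)
  from dpred_compose[OF this dfun_snd[OF dfun_id]] show ?thesis unfolding dfun_def .
qed

section \<open>Arithmetic, order and suprema\<close>

lemma dfun_arith_aux:
  assumes "{[x, y, h x y] | x y. True} \<in> S 3"
  shows "dfun (\<lambda>z :: real \<times> real. h (fst z) (snd z))"
proof -
  let ?bs = "[((1, 0), 0), ((0, 1), 0), (0, 1)] :: ((real \<times> real) \<times> real) list"
  have "dpred (\<lambda>u :: (real \<times> real) \<times> real. map (\<lambda>b. u \<bullet> b) ?bs \<in> {[x, y, h x y] | x y. True})"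
    using assms by (intro dpred_coordinates) (simp_all add: numeral_3_eq_3 Basis_prod_def zero_prod_def)
  thus ?thesis by (simp add: dfun_def inner_prod_def)
qed

lemma dfun_add_real: "dfun f \<Longrightarrow> dfun g \<Longrightarrow> dfun (\<lambda>x. f x + g x :: real)"
  by (rule dfun_compose2[OF dfun_arith_aux[OF addition]])

lemma dfun_mult [definability]: "dfun f \<Longrightarrow> dfun g \<Longrightarrow> dfun (\<lambda>x. f x * g x :: real)"
  by (rule dfun_compose2[OF dfun_arith_aux[OF multiplication]])

lemma dfun_componentwise:
  fixes f :: "'a::euclidean_space \<Rightarrow> 'b::euclidean_space"
  assumes "\<And>b. b \<in> Basis \<Longrightarrow> dfun (\<lambda>x. f x \<bullet> b)"
  shows "dfun f"
proof (rule dfunI)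
  show "dpred (\<lambda>z. \<forall>b\<in>Basis. snd z \<bullet> b = f (fst z) \<bullet> b)"
    by (intro dpred_finite_all finite_Basis dfunD assms coordinate_map_intros)
qed (simp flip: euclidean_eq_iff)

lemma dfun_add [definability]: "dfun f \<Longrightarrow> dfun g \<Longrightarrow> dfun (\<lambda>x. f x + g x)"
  by (rule dfun_componentwise) (auto simp: inner_add_left intro!: dfun_add_real dfun_inner_Basis)

lemma dfun_diff [definability]:
  assumes "dfun f" "dfun g"
  shows "dfun (\<lambda>x. f x - g x)"
proof (rule dfunI)
  show "dpred (\<lambda>z. snd z + g (fst z) = f (fst z))"
    by (intro definability dfun_compose[OF assms(1)] dfun_compose[OF assms(2)])
qed (auto simp: algebra_simps)

lemma dfun_minus [definability]: "dfun f \<Longrightarrow> dfun (\<lambda>x. - f x)"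
  using dfun_diff[OF dfun_const[of 0], of f] by simp

text \<open>The order is not among the axioms; it is recovered from the field operations, since
  \<open>g x - f x\<close> is positive exactly if it is a nonzero square.\<close>

lemma dpred_less [definability]:
  assumes "dfun f" "dfun g"
  shows "dpred (\<lambda>x. f x < (g x :: real))"
proof -
  have "dpred (\<lambda>x. \<exists>z. z \<noteq> 0 \<and> g x = f x + z * z)"
    by (intro definability dfun_compose[OF assms(1)] dfun_compose[OF assms(2)])
  moreover have "(\<exists>z. z \<noteq> 0 \<and> g x = f x + z * z) \<longleftrightarrow> f x < g x" for x
  proof
    assume "f x < g x"
    thus "\<exists>z. z \<noteq> 0 \<and> g x = f x + z * z" by (intro exI[of _ "sqrt (g x - f x)"]) simp
  qed (auto simp flip: power2_eq_square)
  ultimately show ?thesis by simp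
qed

lemma dpred_le [definability]:
  assumes "dfun f" "dfun g"
  shows "dpred (\<lambda>x. f x \<le> (g x :: real))"
  using dpred_not[OF dpred_less[OF assms(2,1)]] by (simp add: not_less)

lemma dfun_if [definability]:
  assumes "dpred P" "dfun f" "dfun g"
  shows "dfun (\<lambda>x. if P x then f x else g x)"
proof (rule dfunI)
  show "dpred (\<lambda>z. (P (fst z) \<longrightarrow> snd z = f (fst z)) \<and> (\<not> P (fst z) \<longrightarrow> snd z = g (fst z)))"
    by (intro definability dpred_compose[OF assms(1)] dfun_compose[OF assms(2)]
        dfun_compose[OF assms(3)])
qed auto

lemma dfun_divide [definability]:
  assumes "dfun f" "dfun g"
  shows "dfun (\<lambda>x. f x / (g x :: real))"
proof (rule dfunI)
  \<comment> \<open>Division by zero yields \<open>0\<close>, which the first case records.\<close>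
  show "dpred (\<lambda>z. if g (fst z) = 0 then snd z = 0 else snd z * g (fst z) = f (fst z))"
    unfolding if_bool_eq_conj
    by (intro definability dfun_compose[OF assms(1)] dfun_compose[OF assms(2)])
qed (auto simp: field_simps)

lemma dfun_abs [definability]: "dfun f \<Longrightarrow> dfun (\<lambda>x. \<bar>f x :: real\<bar>)"
  unfolding abs_if by (intro definability)

lemma dfun_power [definability]: "dfun f \<Longrightarrow> dfun (\<lambda>x. f x ^ n :: real)"
  by (induction n) (simp_all add: dfun_const dfun_mult)

lemma dfun_sum:
  "finite I \<Longrightarrow> (\<And>i. i \<in> I \<Longrightarrow> dfun (f i)) \<Longrightarrow> dfun (\<lambda>x. \<Sum>i\<in>I. f i x)"
  by (induction I rule: finite_induct) (simp_all add: dfun_const dfun_add)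

lemma dfun_sqrt [definability]: "dfun f \<Longrightarrow> dfun (\<lambda>x. sqrt (f x))"
proof (erule dfun_compose[rotated], rule dfunI)
  \<comment> \<open>\<open>sqrt\<close> is extended to negative arguments as an odd function, hence
    the absolute value and the sign conditions.\<close>
  show "dpred (\<lambda>z :: real \<times> real. snd z * snd z = \<bar>fst z\<bar> \<and> (0 \<le> fst z \<longrightarrow> 0 \<le> snd z) \<and> (fst z \<le> 0 \<longrightarrow> snd z \<le> 0))"
    by (intro definability)
  show "y * y = \<bar>x\<bar> \<and> (0 \<le> x \<longrightarrow> 0 \<le> y) \<and> (x \<le> 0 \<longrightarrow> y \<le> 0) \<longleftrightarrow> y = sqrt x" for x y
    using real_sqrt_unique[of "- y" "- x"]
    by (auto simp: abs_if real_sqrt_unique power2_eq_square real_sqrt_minus)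
qed

lemma dfun_dist [definability]:
  assumes "dfun f" "dfun g"
  shows "dfun (\<lambda>x. dist (f x) (g x))"
  unfolding euclidean_dist_l2[of "f _"] L2_set_def dist_real_def
  by (intro definability dfun_sum finite_Basis dfun_inner_Basis assms)

lemma dfun_Sup:
  fixes R :: "'a::euclidean_space \<Rightarrow> real \<Rightarrow> bool"
  assumes "dpred (\<lambda>z. R (fst z) (snd z))" and "\<And>x. \<exists>s. R x s" and "\<And>x. bdd_above {s. R x s}"
  shows "dfun (\<lambda>x. Sup {s. R x s})"
proof (rule dfunI)
  \<comment> \<open>A supremum is determined by its set of upper bounds, and this characterization
    is first-order because \<open>w\<close> and \<open>s\<close> range over reals.\<close>
  show "dpred (\<lambda>z. \<forall>w. snd z \<le> w \<longleftrightarrow> (\<forall>s. R (fst z) s \<longrightarrow> s \<le> w))"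
    unfolding iff_conv_conj_imp
    by (intro definability dpred_compose2[OF assms(1)])
  fix x y
  have "Sup {s. R x s} \<le> w \<longleftrightarrow> (\<forall>s. R x s \<longrightarrow> s \<le> w)" for w
    using cSup_le_iff[of "{s. R x s}" w] assms(2,3)[of x] by auto
  thus "(\<forall>w. y \<le> w \<longleftrightarrow> (\<forall>s. R x s \<longrightarrow> s \<le> w)) \<longleftrightarrow> y = Sup {s. R x s}"
    by (metis order_antisym order_refl)
qed

end

section \<open>Differentiability of definable functions of one variable\<close>

text \<open>Each strict local minimum is strict on some interval with rational endpoints. Two points
  sharing such an interval would each have the smaller value, so the choice of endpoints is
  injective.\<close>

lemma countable_strict_local_minima:
  fixes g :: "real \<Rightarrow> 'b::order"
  shows "countable {x. \<forall>\<^sub>F y in at x. g x < g y}" (is "countable ?M")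
proof -
  let ?Q = "\<lambda>x (p, q). p \<in> \<rat> \<and> q \<in> \<rat> \<and> p < x \<and> x < q \<and>
    (\<forall>y. p < y \<and> y < q \<and> y \<noteq> x \<longrightarrow> g x < g y)"
  have "\<forall>x\<in>?M. \<exists>pq. ?Q x pq"
  proof
    fix x assume x: "x \<in> ?M"
    obtain d where d: "d > 0" "\<And>y. y \<noteq> x \<Longrightarrow> dist y x < d \<Longrightarrow> g x < g y"
      using x by (auto simp: eventually_at)
    obtain p where p: "p \<in> \<rat>" "x - d < p" "p < x" using Rats_dense_in_real[of "x - d" x] d by auto
    obtain q where q: "q \<in> \<rat>" "x < q" "q < x + d" using Rats_dense_in_real[of x "x + d"] d by auto
    show "\<exists>pq. ?Q x pq" using p q d(2) by (intro exI[of _ "(p, q)"]) (auto simp: dist_real_def)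
  qed
  from bchoice[OF this] obtain h where h: "\<forall>x\<in>?M. ?Q x (h x)" ..
  have "inj_on h ?M"
  proof (rule inj_onI, rule ccontr)
    fix x y assume xy: "x \<in> ?M" "y \<in> ?M" "h x = h y" "x \<noteq> y"
    obtain p q where pq: "h x = (p, q)" by fastforce
    have "g x < g y" "g y < g x" using bspec[OF h xy(1)] bspec[OF h xy(2)] xy(3,4) pq by auto
    thus False by order
  qed
  moreover have "h ` ?M \<subseteq> \<rat> \<times> \<rat>"
  proof
    fix z assume "z \<in> h ` ?M"
    then obtain x where x: "x \<in> ?M" "z = h x" by (rule imageE)
    show "z \<in> \<rat> \<times> \<rat>" using bspec[OF h x(1)] x(2) by (cases z) auto
  qed
  hence "countable (h ` ?M)"
    by (rule countable_subset) (intro countable_SIGMA countable_rat)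
  ultimately show ?thesis by (rule countable_image_inj_on[rotated])
qed

lemma eventually_left_right: "(\<forall>\<^sub>F y in at_left x. y < x) \<and> (\<forall>\<^sub>F y in at_right x. x < y)" for x :: real
  by (simp add: eventually_at_filter)

text \<open>Where the left derivative is below some rational \<open>r\<close> and the right derivative above it,
  \<open>f y - r * y\<close> has a strict local minimum.\<close>

lemma countable_left_less_right_derivative:
  fixes f :: "real \<Rightarrow> real"
  assumes "\<And>x. ((\<lambda>y. ereal ((f y - f x) / (y - x))) \<longlongrightarrow> L x) (at_left x)"
    and "\<And>x. ((\<lambda>y. ereal ((f y - f x) / (y - x))) \<longlongrightarrow> R x) (at_right x)"
  shows "countable {x. L x < R x}"
proof (rule countable_subset)
  let ?M = "\<lambda>r. {x. \<forall>\<^sub>F y in at x. f x - of_rat r * x < f y - of_rat r * y}"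
  show "countable (\<Union>r. ?M r)"
    by (intro countable_UN countable_strict_local_minima) auto
  show "{x. L x < R x} \<subseteq> (\<Union>r. ?M r)"
  proof
    fix x assume "x \<in> {x. L x < R x}"
    then obtain r where r: "L x < ereal (of_rat r)" "ereal (of_rat r) < R x"
      using ereal_dense3[of "L x" "R x"] by auto
    have "\<forall>\<^sub>F y in at_left x. ereal ((f y - f x) / (y - x)) < ereal (of_rat r)"
      using order_tendstoD(2)[OF assms(1) r(1)] .
    hence "\<forall>\<^sub>F y in at_left x. f x - of_rat r * x < f y - of_rat r * y"
      using eventually_left_right[of x, THEN conjunct1]
      by eventually_elim (auto simp: field_simps)
    moreover have "\<forall>\<^sub>F y in at_right x. ereal (of_rat r) < ereal ((f y - f x) / (y - x))"
      using order_tendstoD(1)[OF assms(2) r(2)] .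
    hence "\<forall>\<^sub>F y in at_right x. f x - of_rat r * x < f y - of_rat r * y"
      using eventually_left_right[of x, THEN conjunct2]
      by eventually_elim (auto simp: field_simps)
    ultimately show "x \<in> (\<Union>r. ?M r)" by (auto simp: eventually_at_split)
  qed
qed

lemma countable_left_neq_right_derivative:
  fixes f :: "real \<Rightarrow> real"
  assumes L: "\<And>x. ((\<lambda>y. ereal ((f y - f x) / (y - x))) \<longlongrightarrow> L x) (at_left x)"
    and R: "\<And>x. ((\<lambda>y. ereal ((f y - f x) / (y - x))) \<longlongrightarrow> R x) (at_right x)"
  shows "countable {x. L x \<noteq> R x}"
proof -
  have neg: "ereal ((- f y - - f x) / (y - x)) = - ereal ((f y - f x) / (y - x))" for x y
    by (simp add: minus_divide_left)
  \<comment> \<open>The opposite inequality is the same statement for \<open>- f\<close>, which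
    negates both one-sided derivatives.\<close>
  have "countable {x. - L x < - R x}"
    by (rule countable_left_less_right_derivative[of "\<lambda>x. - f x"]; unfold neg)
      (intro tendsto_uminus_ereal L R)+
  hence "countable ({x. L x < R x} \<union> {x. R x < L x})"
    using countable_left_less_right_derivative[OF L R] by auto
  moreover have "{x. L x < R x} \<union> {x. R x < L x} = {x. L x \<noteq> R x}" by auto
  ultimately show ?thesis by simp
qed

text \<open>For \<open>N\<close> above the mean slope, \<open>f x - N * x\<close> does not decrease
  across any point of the interval at small scale. Bisection extends this to the endpoints
  \<open>u\<close> and \<open>v\<close>, so the mean slope is at least \<open>N\<close>.\<close>

lemma no_infinite_derivative_on_interval:
  fixes f :: "real \<Rightarrow> real"
  assumes "u < v" and "\<And>x N. u \<le> x \<Longrightarrow> x \<le> v \<Longrightarrow> \<forall>\<^sub>F y in at x. N < (f y - f x) / (y - x)"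
  shows False
proof -
  define N where "N = (f v - f u) / (v - u) + 1"
  have "f u - N * u \<le> f v - N * v"
  proof (rule Bolzano[of u v "\<lambda>a b. f a - N * a \<le> f b - N * b"])
    fix x assume "u \<le> x" "x \<le> v"
    from assms(2)[OF this, of N] obtain d where d: "d > 0"
      "\<And>y. y \<noteq> x \<Longrightarrow> dist y x < d \<Longrightarrow> N < (f y - f x) / (y - x)"
      by (auto simp: eventually_at)
    show "\<exists>d>0. \<forall>a b. a \<le> x \<and> x \<le> b \<and> b - a < d \<longrightarrow> f a - N * a \<le> f b - N * b"
    proof (intro exI[of _ d] conjI d(1) allI impI)
      fix a b assume ab: "a \<le> x \<and> x \<le> b \<and> b - a < d"
      have "f a - N * a \<le> f x - N * x"
      proof (cases "a = x")
        case False
        hence "N < (f a - f x) / (a - x)" using ab by (intro d) (auto simp: dist_real_def)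
        thus ?thesis using False ab by (simp add: field_simps)
      qed simp
      moreover have "f x - N * x \<le> f b - N * b"
      proof (cases "b = x")
        case False
        hence "N < (f b - f x) / (b - x)" using ab by (intro d) (auto simp: dist_real_def)
        thus ?thesis using False ab by (simp add: field_simps)
      qed simp
      ultimately show "f a - N * a \<le> f b - N * b" by simp
    qed
  qed (use assms(1) in auto)
  hence "N \<le> (f v - f u) / (v - u)" using assms(1) by (simp add: field_simps)
  thus False by (simp add: N_def)
qed

section \<open>One-sided behaviour of definable predicates and functions\<close>

lemma eventually_interval_at_right:
  fixes I :: "real set"
  assumes "is_interval I"
  shows "(\<forall>\<^sub>F x in at_right c. x \<in> I) \<or> (\<forall>\<^sub>F x in at_right c. x \<notin> I)"
proof (cases "\<forall>b>c. \<exists>x. c < x \<and> x < b \<and> x \<in> I")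
  case True
  then obtain b where b: "c < b" "b \<in> I" by (metis gt_ex)
  have "x \<in> I" if x: "c < x" "x < b" for x
  proof -
    obtain y where "y < x" "y \<in> I" using True x(1) by blast
    thus ?thesis using assms b x unfolding is_interval_1 by (meson less_imp_le)
  qed
  thus ?thesis using b(1) by (auto simp: eventually_at_right_field)
next
  case False
  thus ?thesis by (auto simp: eventually_at_right_field)
qed

text \<open>The limit is the supremum of the \<open>r\<close> that \<open>q\<close> eventually
  exceeds. A real number above that supremum is not eventually exceeded, so by the dichotomy it
  eventually bounds \<open>q\<close>. Infinite limits are included.\<close>

lemma ereal_limit_of_dichotomy:
  fixes q :: "'a \<Rightarrow> real"
  assumes "\<And>r. (\<forall>\<^sub>F x in F. r < q x) \<or> (\<forall>\<^sub>F x in F. \<not> r < q x)"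
  shows "\<exists>l. ((\<lambda>x. ereal (q x)) \<longlongrightarrow> l) F"
proof
  let ?R = "{ereal r | r. \<forall>\<^sub>F x in F. r < q x}"
  show "((\<lambda>x. ereal (q x)) \<longlongrightarrow> Sup ?R) F"
  proof (rule order_tendstoI)
    fix a assume "a < Sup ?R"
    then obtain r where "a < ereal r" "\<forall>\<^sub>F x in F. r < q x" by (auto simp: less_Sup_iff)
    from this(2) show "\<forall>\<^sub>F x in F. a < ereal (q x)"
      by eventually_elim (use \<open>a < ereal r\<close> in \<open>meson ereal_less_eq(3) less_le_not_le order.strict_trans2 less_imp_le\<close>)
  next
    fix a assume a: "Sup ?R < a"
    obtain r where r: "Sup ?R < ereal r" "ereal r < a" using ereal_dense2[OF a] by auto
    have "\<not> (\<forall>\<^sub>F x in F. r < q x)"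
    proof
      assume "\<forall>\<^sub>F x in F. r < q x"
      hence "ereal r \<le> Sup ?R" by (intro Sup_upper) auto
      thus False using r(1) by simp
    qed
    hence "\<forall>\<^sub>F x in F. \<not> r < q x" using assms by blast
    thus "\<forall>\<^sub>F x in F. ereal (q x) < a"
      by eventually_elim (use r(2) in \<open>metis ereal_less_eq(3) not_less order.strict_trans1\<close>)
  qed
qed

context o_minimal_structure
begin

text \<open>Here o-minimality enters: a definable subset of the line is a finite union of intervals,
  and each interval either contains or avoids all points just to the right of
  \<open>c\<close>.\<close>

lemma dpred_dichotomy_right:
  fixes c :: real
  assumes "dpred P"
  shows "(\<forall>\<^sub>F x in at_right c. P x) \<or> (\<forall>\<^sub>F x in at_right c. \<not> P x)"
proof -
  have *: "xs = [1]" if "set xs = {1}" "length xs = 1" for xs :: "real list"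
    using that by (cases xs) simp_all
  have basis: "(basis_list :: real list) = [1]" by (rule *) (simp_all add: basis_list)
  hence "coords x = [x]" for x :: real unfolding coords_def basis by simp
  hence "(\<lambda>t. [t]) ` {x. P x} \<in> S 1" using assms by (simp add: dpred_def definable_def)
  then obtain \<I> where I: "finite \<I>" "\<forall>I\<in>\<I>. is_interval I" "(\<lambda>t. [t]) ` {x. P x} = (\<lambda>t. [t]) ` (\<Union>\<I>)"
    unfolding tame by blast
  have "{x. P x} = \<Union>\<I>" using I(3) by (subst (asm) inj_image_eq_iff) (auto simp: inj_def)
  hence P: "P = (\<lambda>x. x \<in> \<Union>\<I>)" by (auto simp: set_eq_iff fun_eq_iff)
  show ?thesis
    unfolding P using I(1,2)
  proof (induction rule: finite_induct)
    case (insert I \<J>)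
    show ?case
    proof (cases "(\<forall>\<^sub>F x in at_right c. x \<in> I) \<or> (\<forall>\<^sub>F x in at_right c. x \<in> \<Union>\<J>)")
      case True
      thus ?thesis by (intro disjI1) (auto elim: eventually_mono)
    next
      case False
      hence "\<forall>\<^sub>F x in at_right c. x \<notin> I" "\<forall>\<^sub>F x in at_right c. x \<notin> \<Union>\<J>"
        using insert eventually_interval_at_right[of I c] by auto
      thus ?thesis by (intro disjI2) (auto simp: eventually_conj_iff)
    qed
  qed simp
qed

lemma dpred_dichotomy_left:
  fixes c :: real
  assumes "dpred P"
  shows "(\<forall>\<^sub>F x in at_left c. P x) \<or> (\<forall>\<^sub>F x in at_left c. \<not> P x)"
  unfolding at_left_minus[of c] eventually_filtermap
  by (rule dpred_dichotomy_right[OF dpred_compose[OF assms dfun_minus[OF dfun_id]]])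

lemma dfun_limit_right: "dfun q \<Longrightarrow> \<exists>l. ((\<lambda>x. ereal (q x)) \<longlongrightarrow> l) (at_right c)" for c :: real
  by (intro ereal_limit_of_dichotomy dpred_dichotomy_right definability)

lemma dfun_limit_left: "dfun q \<Longrightarrow> \<exists>l. ((\<lambda>x. ereal (q x)) \<longlongrightarrow> l) (at_left c)" for c :: real
  by (intro ereal_limit_of_dichotomy dpred_dichotomy_left definability)

lemma dpred_DERIV:
  assumes "dfun f"
  shows "dpred (\<lambda>z. (f has_real_derivative snd z) (at (fst z)))"
proof -
  have "dpred (\<lambda>z. \<forall>e. 0 < e \<longrightarrow> (\<exists>d. 0 < d \<and> (\<forall>y. y \<noteq> fst z \<and> \<bar>y - fst z\<bar> < d \<longrightarrow>
      \<bar>(f y - f (fst z)) / (y - fst z) - snd z\<bar> < e)))"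
    by (intro definability dfun_compose[OF assms])
  thus ?thesis by (simp add: has_field_derivative_iff LIM_eq)
qed

lemma dfun_deriv:
  assumes "dfun f"
  shows "dfun (deriv f :: real \<Rightarrow> real)"
proof (rule dfunI)
  \<comment> \<open>Where \<open>f\<close> has no derivative, \<open>deriv f x\<close> is a choice
    from an empty set and so the same real number at all such points.\<close>
  define c where "c = (SOME D :: real. False)"
  let ?D = "\<lambda>x y. (f has_real_derivative y) (at x)"
  have D: "dpred (\<lambda>x. ?D (g x) (h x))" if "dfun g" "dfun h" for g h :: "'z::euclidean_space \<Rightarrow> real"
    using dpred_compose2[OF dpred_DERIV[OF assms] that] .
  show "dpred (\<lambda>z. ?D (fst z) (snd z) \<or> (\<not> (\<exists>y. ?D (fst z) y)) \<and> snd z = c)"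
    by (intro definability D)
  show "?D x y \<or> (\<not> (\<exists>y. ?D x y)) \<and> y = c \<longleftrightarrow> y = deriv f x" for x y
  proof (cases "\<exists>l. ?D x l")
    case True
    then obtain l where "?D x l" ..
    thus ?thesis using DERIV_unique DERIV_imp_deriv by metis
  next
    case False
    thus ?thesis by (simp add: deriv_def c_def)
  qed
qed

lemma dpred_infinite_derivative:
  assumes "dfun f"
  shows "dpred (\<lambda>x :: real. \<forall>N. \<forall>\<^sub>F y in at x. N < (f y - f x) / (y - x))"
proof -
  have "dpred (\<lambda>x. \<forall>N. \<exists>d. 0 < d \<and> (\<forall>y. y \<noteq> x \<and> \<bar>y - x\<bar> < d \<longrightarrow> N < (f y - f x) / (y - x)))"
    by (intro definability dfun_compose[OF assms])
  thus ?thesis by (simp add: eventually_at dist_real_def)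
qed

text \<open>By the dichotomy the contrary would give an infinite derivative on an entire
  interval.\<close>

lemma not_eventually_infinite_derivative:
  fixes f :: "real \<Rightarrow> real"
  assumes "dfun f"
  shows "\<forall>\<^sub>F x in at_right c. \<not> (\<forall>N. \<forall>\<^sub>F y in at x. N < (f y - f x) / (y - x))"
    (is "\<forall>\<^sub>F x in _. \<not> ?P x")
proof (rule ccontr)
  assume "\<not> ?thesis"
  hence "\<forall>\<^sub>F x in at_right c. ?P x"
    using dpred_dichotomy_right[OF dpred_infinite_derivative[OF assms]] by blast
  then obtain b where b: "b > c" "\<And>x. c < x \<Longrightarrow> x < b \<Longrightarrow> ?P x" by (auto simp: eventually_at_right_field)
  obtain v where v: "c < v" "v < b" using dense[OF b(1)] by auto
  obtain u where u: "c < u" "u < v" using dense[OF v(1)] by auto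
  show False
    by (rule no_infinite_derivative_on_interval[OF u(2), of f]) (use b(2) u v in auto)
qed

theorem eventually_differentiable:
  fixes f :: "real \<Rightarrow> real"
  assumes f: "dfun f"
  shows "\<forall>\<^sub>F x in at_right c. (f has_real_derivative deriv f x) (at x)"
proof -
  let ?q = "\<lambda>x y. (f y - f x) / (y - x)"
  have q: "dfun (?q x)" for x by (intro definability f)
  have "\<forall>x. \<exists>l. ((\<lambda>y. ereal (?q x y)) \<longlongrightarrow> l) (at_left x)"
    using dfun_limit_left[OF q] by blast
  from choice[OF this] obtain L where L: "\<And>x. ((\<lambda>y. ereal (?q x y)) \<longlongrightarrow> L x) (at_left x)"
    by blast
  have "\<forall>x. \<exists>l. ((\<lambda>y. ereal (?q x y)) \<longlongrightarrow> l) (at_right x)"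
    using dfun_limit_right[OF q] by blast
  from choice[OF this] obtain R where R: "\<And>x. ((\<lambda>y. ereal (?q x y)) \<longlongrightarrow> R x) (at_right x)"
    by blast
  let ?D = "\<lambda>x. \<exists>l. (f has_real_derivative l) (at x)"
  let ?P = "\<lambda>f x. \<forall>N. \<forall>\<^sub>F y in at x. N < (f y - f x) / (y - x)"
  \<comment> \<open>Where the one-sided derivatives agree, the common value is finite or infinite;
    the value minus infinity is recorded as an infinite derivative of \<open>- f\<close>.\<close>
  have cases: "?D x \<or> ?P f x \<or> ?P (\<lambda>x. - f x) x" if "L x = R x" for x
  proof -
    have lim: "((\<lambda>y. ereal (?q x y)) \<longlongrightarrow> R x) (at x)"
      using filterlim_split_at[OF L[of x] R[of x, folded that]] that by simp
    show ?thesis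
    proof (cases "R x")
      case (real l)
      thus ?thesis using lim by (auto simp: has_field_derivative_iff)
    next
      case PInf
      thus ?thesis using lim by (auto simp: tendsto_PInfty)
    next
      case MInf
      have "\<forall>\<^sub>F y in at x. N < (- f y - - f x) / (y - x)" for N
      proof -
        have "\<forall>\<^sub>F y in at x. ereal (?q x y) < ereal (- N)"
          using lim by (simp add: tendsto_MInfty MInf)
        moreover have "(- f y - - f x) / (y - x) = - ?q x y" for y by (simp add: minus_divide_left)
        ultimately show ?thesis by (auto elim: eventually_mono)
      qed
      thus ?thesis by blast
    qed
  qed
  have "\<forall>\<^sub>F x in at_right c. ?D x"
  proof (rule ccontr)
    assume "\<not> ?thesis"
    moreover have "dpred ?D" by (intro definability dpred_DERIV f)
    ultimately have "\<forall>\<^sub>F x in at_right c. \<not> ?D x" using dpred_dichotomy_right by blast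
    \<comment> \<open>Infinite derivatives are excluded near \<open>c\<close>, so failure of
      differentiability would make the one-sided derivatives differ on a whole interval, an
      uncountable set.\<close>
    hence "\<forall>\<^sub>F x in at_right c. L x \<noteq> R x"
      using not_eventually_infinite_derivative[OF f, of c]
        not_eventually_infinite_derivative[OF dfun_minus[OF f], of c]
      by eventually_elim (use cases in blast)
    then obtain b where "b > c" "\<forall>x>c. x < b \<longrightarrow> L x \<noteq> R x" by (auto simp: eventually_at_right_field)
    moreover from this(2) have "{c<..<b} \<subseteq> {x. L x \<noteq> R x}" by auto
    moreover have "countable {x. L x \<noteq> R x}" by (rule countable_left_neq_right_derivative[OF L R])
    ultimately show False using uncountable_open_interval[of c b] countable_subset by blast
  qed
  thus ?thesis by eventually_elim (auto dest: DERIV_imp_deriv)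
qed

end

section \<open>Flat functions\<close>

text \<open>For an open \<open>U\<close> containing \<open>Z\<close> this is class C^k on
  \<open>U\<close> with all derivatives up to order \<open>k\<close> zero on \<open>Z\<close>;
  \<open>Z = {}\<close> leaves plain regularity. Carrying a derivative as a witness lets closure
  under products and composition follow by induction on the order.\<close>

primrec flat_C :: "nat \<Rightarrow> real set \<Rightarrow> real set \<Rightarrow> (real \<Rightarrow> real) \<Rightarrow> bool" where
  "flat_C 0 U Z f \<longleftrightarrow> continuous_on U f \<and> (\<forall>z\<in>Z. f z = 0)"
| "flat_C (Suc k) U Z f \<longleftrightarrow> (\<forall>z\<in>Z. f z = 0) \<and>
     (\<exists>g. (\<forall>x\<in>U. (f has_real_derivative g x) (at x)) \<and> flat_C k U Z g)"

lemma flat_C_SucI: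
  assumes "\<And>z. z \<in> Z \<Longrightarrow> f z = 0"
    and "\<And>x. x \<in> U \<Longrightarrow> (f has_real_derivative g x) (at x)" and "flat_C k U Z g"
  shows "flat_C (Suc k) U Z f"
  using assms by auto

lemma flat_C_SucE:
  assumes "flat_C (Suc k) U Z f"
  obtains g where "\<And>z. z \<in> Z \<Longrightarrow> f z = 0"
    "\<And>x. x \<in> U \<Longrightarrow> (f has_real_derivative g x) (at x)" "flat_C k U Z g"
  using assms by auto

lemma flat_C_imp_continuous_on:
  assumes "flat_C k U Z f"
  shows "continuous_on U f"
proof (cases k)
  case (Suc l)
  with assms obtain g where "\<And>x. x \<in> U \<Longrightarrow> (f has_real_derivative g x) (at x)"
    by (auto elim: flat_C_SucE)
  thus ?thesis by (intro DERIV_continuous_on[OF has_field_derivative_at_within])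
qed (use assms in simp)

lemma flat_C_Suc_imp: "flat_C (Suc k) U Z f \<Longrightarrow> flat_C k U Z f"
proof (induction k arbitrary: f)
  case 0
  thus ?case using flat_C_imp_continuous_on[OF 0] by simp
next
  case (Suc k)
  from Suc.prems obtain g where "\<forall>z\<in>Z. f z = 0" "\<forall>x\<in>U. (f has_real_derivative g x) (at x)"
    "flat_C (Suc k) U Z g" unfolding flat_C.simps(2)[of "Suc k"] by blast
  thus ?case using Suc.IH[of g] by auto
qed

lemma flat_C_subset:
  assumes "flat_C k U Z f" "V \<subseteq> U" "Y \<subseteq> Z"
  shows "flat_C k V Y f"
  using assms(1)
proof (induction k arbitrary: f)
  case 0
  thus ?case using assms(2,3) by (auto intro: continuous_on_subset)
next
  case (Suc k)
  from Suc.prems obtain g where g: "\<And>z. z \<in> Z \<Longrightarrow> f z = 0"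
    "\<And>x. x \<in> U \<Longrightarrow> (f has_real_derivative g x) (at x)" "flat_C k U Z g" using flat_C_SucE by blast
  show ?case by (rule flat_C_SucI[OF _ _ Suc.IH[OF g(3)]]) (use g assms(2,3) in auto)
qed

lemma flat_C_const: "flat_C k U {} (\<lambda>x. c)"
proof (induction k arbitrary: c)
  case (Suc k)
  show ?case by (rule flat_C_SucI[OF _ _ Suc[of 0]]) auto
qed simp

lemma flat_C_id: "flat_C k U {} (\<lambda>x. x)"
proof (cases k)
  case (Suc l)
  show ?thesis unfolding Suc by (rule flat_C_SucI[OF _ _ flat_C_const[of _ U 1]]) auto
qed simp

lemma flat_C_add: "flat_C k U Z f \<Longrightarrow> flat_C k U Z g \<Longrightarrow> flat_C k U Z (\<lambda>x. f x + g x)"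
proof (induction k arbitrary: f g)
  case (Suc k)
  from Suc.prems(1) obtain f' where f: "\<forall>z\<in>Z. f z = 0"
    "\<forall>x\<in>U. (f has_real_derivative f' x) (at x)" "flat_C k U Z f'" by auto
  from Suc.prems(2) obtain g' where g: "\<forall>z\<in>Z. g z = 0"
    "\<forall>x\<in>U. (g has_real_derivative g' x) (at x)" "flat_C k U Z g'" by auto
  have "\<forall>x\<in>U. ((\<lambda>x. f x + g x) has_real_derivative f' x + g' x) (at x)"
    using f g by (auto intro!: DERIV_add)
  with Suc.IH[OF f(3) g(3)] f(1) g(1) show ?case by auto
qed (auto intro: continuous_on_add)

text \<open>Flatness of one factor suffices, as both terms of the product rule keep a factor that is
  flat on \<open>Z\<close>.\<close>

lemma flat_C_mult: "flat_C k U Z f \<Longrightarrow> flat_C k U {} g \<Longrightarrow> flat_C k U Z (\<lambda>x. f x * g x)"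
proof (induction k arbitrary: f g)
  case (Suc k)
  from Suc.prems(1) obtain f' where f: "\<forall>z\<in>Z. f z = 0"
    "\<forall>x\<in>U. (f has_real_derivative f' x) (at x)" "flat_C k U Z f'" by auto
  from Suc.prems(2) obtain g' where g:
    "\<forall>x\<in>U. (g has_real_derivative g' x) (at x)" "flat_C k U {} g'" by auto
  have "\<forall>x\<in>U. ((\<lambda>x. f x * g x) has_real_derivative f' x * g x + f x * g' x) (at x)"
    using f g by (auto intro!: derivative_eq_intros)
  moreover have "flat_C k U Z (\<lambda>x. f' x * g x + f x * g' x)"
    by (intro flat_C_add Suc.IH f(3) g(2) flat_C_Suc_imp[OF Suc.prems(1)] flat_C_Suc_imp[OF Suc.prems(2)])
  ultimately show ?case using f(1) by auto
qed (auto intro: continuous_on_mult)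

text \<open>By the chain rule the derivative is \<open>f' (g x) * g' x\<close>, whose first factor
  is again a composition with a flat function, of one order less.\<close>

lemma flat_C_compose:
  "flat_C k V Z f \<Longrightarrow> flat_C k U {} g \<Longrightarrow> g ` U \<subseteq> V \<Longrightarrow> g ` Y \<subseteq> Z \<Longrightarrow> flat_C k U Y (\<lambda>x. f (g x))"
proof (induction k arbitrary: f)
  case 0
  thus ?case by (auto intro: continuous_on_compose2)
next
  case (Suc k)
  from Suc.prems(1) obtain f' where f: "\<forall>z\<in>Z. f z = 0"
    "\<forall>x\<in>V. (f has_real_derivative f' x) (at x)" "flat_C k V Z f'" by auto
  from Suc.prems(2) obtain g' where g:
    "\<forall>x\<in>U. (g has_real_derivative g' x) (at x)" "flat_C k U {} g'" by auto
  have "\<forall>x\<in>U. ((\<lambda>x. f (g x)) has_real_derivative f' (g x) * g' x) (at x)"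
    using f(2) g(1) Suc.prems(3) by (auto intro!: DERIV_chain2[where f = f and g = g])
  moreover have "flat_C k U Y (\<lambda>x. f' (g x) * g' x)"
    by (intro flat_C_mult Suc.IH f(3) g(2) flat_C_Suc_imp[OF Suc.prems(2)] Suc.prems(3,4))
  ultimately show ?case using f(1) Suc.prems(4) by auto
qed

text \<open>With \<open>s = 1 / sqrt (1 + t\<^sup>2)\<close> one has
  \<open>s' = - t * s ^ 3\<close>, so regularity of order \<open>k\<close> passes from
  \<open>s\<close> to its derivative and gives order \<open>k + 1\<close>.\<close>

lemma flat_C_inverse_sqrt: "flat_C k UNIV {} (\<lambda>t. 1 / sqrt (1 + t\<^sup>2))"
proof (induction k)
  case 0
  have "1 + t\<^sup>2 \<noteq> 0" for t :: real
    using add_pos_nonneg[of 1 "t\<^sup>2"] by simp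
  thus ?case by (auto intro!: continuous_intros)
next
  case (Suc k)
  let ?s = "\<lambda>t :: real. 1 / sqrt (1 + t\<^sup>2)"
  show ?case
  proof (rule flat_C_SucI)
    fix t :: real
    have "1 + t\<^sup>2 > 0" by (simp add: add_pos_nonneg)
    moreover from this have "sqrt (1 + t\<^sup>2) * sqrt (1 + t\<^sup>2) = 1 + t\<^sup>2" by simp
    ultimately show "(?s has_real_derivative (- 1) * t * ?s t * ?s t * ?s t) (at t)"
      by (auto intro!: derivative_eq_intros simp: field_simps)
  next
    show "flat_C k UNIV {} (\<lambda>t. (- 1) * t * ?s t * ?s t * ?s t)"
      by (intro flat_C_mult flat_C_const flat_C_id Suc)
  qed simp
qed

text \<open>On the whole line the witnesses in \<open>flat_C\<close> are forced to be the iterates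
  of \<open>deriv\<close>, the form required by \<open>class_C\<close> and
  \<open>Phi\<close>.\<close>

lemma flat_C_UNIV_imp:
  assumes "flat_C p UNIV Z f"
  shows "class_C p f \<and> (\<forall>k\<le>p. \<forall>z\<in>Z. (deriv ^^ k) f z = 0)"
  using assms
proof (induction p arbitrary: f)
  case 0
  thus ?case by (simp add: class_C_def)
next
  case (Suc p)
  then obtain g where g: "\<And>x. (f has_real_derivative g x) (at x)" "flat_C p UNIV Z g"
    and z: "\<forall>z\<in>Z. f z = 0"
    by auto
  have d: "deriv f = g" using g(1) by (auto intro: DERIV_imp_deriv)
  have S: "(deriv ^^ Suc k) f = (deriv ^^ k) g" for k
    by (simp only: funpow_Suc_right o_apply d)
  have diff: "f differentiable_on UNIV"
    using g(1) by (auto simp: differentiable_on_def real_differentiable_def)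
  have "(\<forall>k<Suc p. P k) \<longleftrightarrow> P 0 \<and> (\<forall>k<p. P (Suc k))" for P
    by (metis Suc_less_eq gr0_conv_Suc less_Suc_eq_0_disj zero_less_Suc)
  moreover have "(\<forall>k\<le>Suc p. P k) \<longleftrightarrow> P 0 \<and> (\<forall>k\<le>p. P (Suc k))" for P
    by (metis Suc_le_mono not0_implies_Suc zero_le)
  ultimately show ?case
    using Suc.IH[OF g(2)] diff z by (simp only: class_C_def S) simp
qed

lemma flat_C_imp_Phi:
  assumes "flat_C p UNIV {0} \<phi>" and odd: "\<And>t. \<phi> (- t) = - \<phi> t" and "strict_mono \<phi>"
    and unbounded: "\<And>y. \<exists>t. y \<le> \<phi> t"
  shows "\<phi> \<in> Phi p"
proof -
  have cont: "continuous_on A \<phi>" for A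
    using flat_C_imp_continuous_on[OF assms(1)] continuous_on_subset by blast
  have "\<exists>t. \<phi> t = y" for y
  proof -
    \<comment> \<open>Oddness turns unboundedness above into unboundedness below; surjectivity then
      follows from the intermediate value theorem.\<close>
    obtain a b where ab: "- y \<le> \<phi> a" "y \<le> \<phi> b" using unbounded by metis
    hence *: "\<phi> (- a) \<le> y" "y \<le> \<phi> b" by (auto simp: odd)
    hence "\<phi> (- a) \<le> \<phi> b" by simp
    hence "- a \<le> b" using strict_mono_less_eq[OF assms(3)] by blast
    thus ?thesis using IVT'[of \<phi> "- a" y b] * cont by auto
  qed
  hence "bij \<phi>" using strict_mono_imp_inj_on[OF assms(3)] by (metis bijI surjI)
  thus ?thesis using flat_C_UNIV_imp[OF assms(1)] assms(3) odd by (auto simp: Phi_def)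
qed

text \<open>If \<open>t\<^sup>2 * u' \<ge> c\<close>, then \<open>u + c / t\<close> has a
  nonnegative derivative near zero, so it stays below its value at a fixed \<open>r\<close> as
  \<open>t\<close> decreases to zero. Yet it tends to infinity, since \<open>u\<close> tends to
  \<open>0\<close>.\<close>

lemma scaled_derivative_not_bounded_below:
  fixes u :: "real \<Rightarrow> real"
  assumes "(u \<longlongrightarrow> 0) (at_right 0)" "c > 0"
    and "\<forall>\<^sub>F t in at_right 0. \<exists>d. (u has_real_derivative d) (at t) \<and> c \<le> t\<^sup>2 * d"
  shows False
proof -
  obtain b where b: "b > 0"
    "\<And>t. 0 < t \<Longrightarrow> t < b \<Longrightarrow> \<exists>d. (u has_real_derivative d) (at t) \<and> c \<le> t\<^sup>2 * d"
    using assms(3) by (auto simp: eventually_at_right_field)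
  define r where "r = b / 2"
  have r: "0 < r" "r < b" using b(1) by (auto simp: r_def)
  have le: "u s + c * inverse s \<le> u r + c * inverse r" if s: "0 < s" "s \<le> r" for s
  proof (rule DERIV_nonneg_imp_nondecreasing[OF s(2)])
    fix t assume t: "s \<le> t" "t \<le> r"
    then obtain d where d: "(u has_real_derivative d) (at t)" "c \<le> t\<^sup>2 * d"
      using b(2)[of t] s r by auto
    have "((\<lambda>s. u s + c * inverse s) has_real_derivative d - c * inverse (t\<^sup>2)) (at t)"
      using d(1) s t by (auto intro!: derivative_eq_intros simp: power2_eq_square)
    moreover have "c * inverse (t\<^sup>2) \<le> d" using d(2) s t by (simp add: field_simps)
    ultimately show "\<exists>y. ((\<lambda>s. u s + c * inverse s) has_real_derivative y) (at t) \<and> 0 \<le> y"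
      by (intro exI[of _ "d - c * inverse (t\<^sup>2)"]) simp
  qed
  have "filterlim (\<lambda>s. u s + c * inverse s) at_top (at_right 0)"
    by (intro filterlim_tendsto_add_at_top[OF assms(1)]
        filterlim_tendsto_pos_mult_at_top[OF tendsto_const assms(2)] filterlim_inverse_at_top_right)
  hence "\<forall>\<^sub>F s in at_right 0. u r + c * inverse r < u s + c * inverse s"
    by (simp add: filterlim_at_top_dense)
  moreover have "\<forall>\<^sub>F s in at_right 0. 0 < s \<and> s \<le> r"
    using r(1) by (auto simp: eventually_at_right_field intro!: exI[of _ r])
  ultimately have "\<forall>\<^sub>F s in at_right (0 :: real). False"
    by eventually_elim (use le in force)
  thus False by simp
qed

text \<open>The extension is even for \<open>\<sigma> = 1\<close> and odd for \<open>\<sigma> = - 1\<close>; differentiation swaps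
  the two cases.\<close>

definition extend_by_parity :: "real \<Rightarrow> (real \<Rightarrow> real) \<Rightarrow> real \<Rightarrow> real" where
  "extend_by_parity \<sigma> h t = (if 0 < t then h t else \<sigma> * h (- t))"

lemma extend_by_parity_odd:
  "h 0 = 0 \<Longrightarrow> extend_by_parity (- 1) h (- t) = - extend_by_parity (- 1) h t"
  by (cases t "0 :: real" rule: linorder_cases) (auto simp: extend_by_parity_def)

text \<open>Away from zero the two branches are differentiated separately, the reflection producing
  the change of sign of \<open>\<sigma>\<close>. At zero both one-sided difference quotients tend to
  \<open>0\<close> because \<open>h t / t\<close> does.\<close>

lemma DERIV_extend_by_parity:
  assumes deriv: "\<And>t. 0 < t \<Longrightarrow> t < e \<Longrightarrow> (h has_real_derivative g t) (at t)"
    and lim: "((\<lambda>t. h t / t) \<longlongrightarrow> 0) (at_right 0)"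
    and zero: "h 0 = 0" "g 0 = 0" and t: "- e < t" "t < e"
  shows "(extend_by_parity \<sigma> h has_real_derivative extend_by_parity (- \<sigma>) g t) (at t)"
proof -
  consider "t > 0" | "t = 0" | "t < 0" by linarith
  thus ?thesis
  proof cases
    case 1
    have "(extend_by_parity \<sigma> h has_real_derivative g t) (at t)"
      by (rule has_field_derivative_transform_within_open[OF deriv[OF 1 t(2)], of "{0<..}"])
        (use 1 in \<open>auto simp: extend_by_parity_def\<close>)
    thus ?thesis using 1 by (simp add: extend_by_parity_def)
  next
    case 2
    have right: "((\<lambda>y. extend_by_parity \<sigma> h y / y) \<longlongrightarrow> 0) (at_right 0)"
      by (rule Lim_transform_eventually[OF lim])
        (auto simp: extend_by_parity_def eventually_at_filter)
    have left: "((\<lambda>y. extend_by_parity \<sigma> h y / y) \<longlongrightarrow> 0) (at_left 0)"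
      unfolding filterlim_at_left_to_right minus_zero
    proof (rule Lim_transform_eventually)
      show "((\<lambda>y. - \<sigma> * (h y / y)) \<longlongrightarrow> 0) (at_right 0)"
        using tendsto_mult[OF tendsto_const lim, of "- \<sigma>"] by simp
      show "\<forall>\<^sub>F y in at_right 0. - \<sigma> * (h y / y) = extend_by_parity \<sigma> h (- y) / - y"
        by (auto simp: extend_by_parity_def eventually_at_filter)
    qed
    show ?thesis
      using filterlim_split_at[OF left right] zero 2
      by (simp add: has_field_derivative_iff extend_by_parity_def)
  next
    case 3
    have "((\<lambda>t. \<sigma> * h (- t)) has_real_derivative - \<sigma> * g (- t)) (at t)"
      using 3 t by (auto intro!: derivative_eq_intros DERIV_chain2[OF deriv])
    hence "(extend_by_parity \<sigma> h has_real_derivative - \<sigma> * g (- t)) (at t)"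
      by (rule has_field_derivative_transform_within_open[of _ _ _ "{..<0}"])
        (use 3 in \<open>auto simp: extend_by_parity_def\<close>)
    thus ?thesis using 3 by (simp add: extend_by_parity_def)
  qed
qed

context o_minimal_structure
begin

text \<open>Up to sign, \<open>t\<^sup>2 * d/dt\<close> is the derivation with respect to \<open>1 / t\<close>: a definable function
  with limit zero at infinity has a derivative with limit zero.\<close>

lemma scaled_derivative_tendsto_zero:
  fixes u :: "real \<Rightarrow> real"
  assumes u: "dfun u" "(u \<longlongrightarrow> 0) (at_right 0)"
  shows "((\<lambda>t. t\<^sup>2 * deriv u t) \<longlongrightarrow> 0) (at_right 0)"
proof (rule tendstoI)
  fix e :: real assume e: "e > 0"
  have d: "\<forall>\<^sub>F t in at_right 0. (u has_real_derivative deriv u t) (at t)"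
    by (rule eventually_differentiable[OF u(1)])
  have "\<not> (\<forall>\<^sub>F t in at_right 0. e \<le> t\<^sup>2 * deriv u t)"
  proof
    assume "\<forall>\<^sub>F t in at_right 0. e \<le> t\<^sup>2 * deriv u t"
    with d have "\<forall>\<^sub>F t in at_right 0. \<exists>d. (u has_real_derivative d) (at t) \<and> e \<le> t\<^sup>2 * d"
      by eventually_elim blast
    from scaled_derivative_not_bounded_below[OF u(2) e this] show False .
  qed
  moreover have "\<not> (\<forall>\<^sub>F t in at_right 0. t\<^sup>2 * deriv u t \<le> - e)"
  proof
    assume "\<forall>\<^sub>F t in at_right 0. t\<^sup>2 * deriv u t \<le> - e"
    with d have "\<forall>\<^sub>F t in at_right 0. \<exists>d. ((\<lambda>t. - u t) has_real_derivative d) (at t) \<and> e \<le> t\<^sup>2 * d"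
      by eventually_elim (auto intro!: exI derivative_eq_intros)
    from scaled_derivative_not_bounded_below[OF tendsto_minus[OF u(2), simplified] e this] show False .
  qed
  moreover have w: "dfun (\<lambda>t. t\<^sup>2 * deriv u t)" by (intro definability dfun_deriv u)
  \<comment> \<open>The dichotomy turns the failure of each bound to hold eventually into its
    eventual negation.\<close>
  ultimately have "\<forall>\<^sub>F t in at_right 0. \<not> e \<le> t\<^sup>2 * deriv u t"
    "\<forall>\<^sub>F t in at_right 0. \<not> t\<^sup>2 * deriv u t \<le> - e"
    using dpred_dichotomy_right[OF dpred_le[OF dfun_const[of e] w], of 0]
      dpred_dichotomy_right[OF dpred_le[OF w dfun_const[of "- e"]], of 0] by blast+
  thus "\<forall>\<^sub>F t in at_right 0. dist (t\<^sup>2 * deriv u t) 0 < e"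
    by eventually_elim auto
qed

text \<open>Only \<open>N - 2\<close> powers are taken out of the derivative, so that the remaining
  factor again tends to zero, by \<open>scaled_derivative_tendsto_zero\<close>, and the step can be
  iterated. \<open>N \<ge> 3\<close> leaves a positive power, so the derivative vanishes at
  zero.\<close>

lemma DERIV_extend_power_mult:
  fixes u :: "real \<Rightarrow> real"
  assumes u: "dfun u" "(u \<longlongrightarrow> 0) (at_right 0)" and N: "3 \<le> N"
  obtains e where "e > 0" "\<And>t. t \<in> {-e<..<e} \<Longrightarrow>
    (extend_by_parity \<sigma> (\<lambda>t. t ^ N * u t) has_real_derivative
      extend_by_parity (- \<sigma>) (\<lambda>t. t ^ (N - 2) * (real N * t * u t + t\<^sup>2 * deriv u t)) t) (at t)"
proof -
  obtain e where e: "e > 0" "\<And>t. 0 < t \<Longrightarrow> t < e \<Longrightarrow> (u has_real_derivative deriv u t) (at t)"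
    using eventually_differentiable[OF u(1), of 0] by (auto simp: eventually_at_right_field)
  define n where "n = N - 2"
  have n: "N = n + 2" "n \<ge> 1" using N by (auto simp: n_def)
  have "((\<lambda>t. t ^ N * u t) has_real_derivative
      t ^ (N - 2) * (real N * t * u t + t\<^sup>2 * deriv u t)) (at t)" if t: "0 < t" "t < e" for t
    by (rule DERIV_cong[OF DERIV_mult[OF DERIV_pow e(2)[OF t]]])
      (simp add: n power2_eq_square algebra_simps)
  moreover have "((\<lambda>t. t ^ N * u t / t) \<longlongrightarrow> 0) (at_right 0)"
  proof (rule Lim_transform_eventually)
    have "((\<lambda>t. t ^ (n + 1) * u t) \<longlongrightarrow> 0 ^ (n + 1) * 0) (at_right 0)"
      by (intro tendsto_intros u)
    thus "((\<lambda>t. t ^ (n + 1) * u t) \<longlongrightarrow> 0) (at_right 0)" by simp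
    show "\<forall>\<^sub>F t in at_right 0. t ^ (n + 1) * u t = t ^ N * u t / t"
      by (auto simp: eventually_at_filter n)
  qed
  ultimately show ?thesis
    using e(1) n by (intro that[of e] DERIV_extend_by_parity) auto
qed

text \<open>Each differentiation replaces \<open>u\<close>, \<open>N\<close> and
  \<open>\<sigma>\<close> by another such function, \<open>N - 2\<close> and
  \<open>- \<sigma>\<close>. After \<open>k\<close> of them the exponent is still at least
  \<open>3\<close>, as the base case requires.\<close>

lemma flat_C_power_mult:
  fixes u :: "real \<Rightarrow> real"
  assumes "dfun u" "(u \<longlongrightarrow> 0) (at_right 0)" "2 * k + 3 \<le> N"
  shows "\<exists>e>0. flat_C k {-e<..<e} {0} (extend_by_parity \<sigma> (\<lambda>t. t ^ N * u t))"
  using assms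
proof (induction k arbitrary: u N \<sigma>)
  case (0 u N \<sigma>)
  have "3 \<le> N" using 0(3) by simp
  from DERIV_extend_power_mult[OF 0(1,2) this, of \<sigma>] obtain e where e: "e > 0"
    "\<And>t. t \<in> {-e<..<e} \<Longrightarrow> (extend_by_parity \<sigma> (\<lambda>t. t ^ N * u t) has_real_derivative
      extend_by_parity (- \<sigma>) (\<lambda>t. t ^ (N - 2) * (real N * t * u t + t\<^sup>2 * deriv u t)) t) (at t)"
    by blast
  have "continuous_on {-e<..<e} (extend_by_parity \<sigma> (\<lambda>t. t ^ N * u t))"
    by (rule DERIV_continuous_on[OF has_field_derivative_at_within[OF e(2)]])
  moreover have "extend_by_parity \<sigma> (\<lambda>t. t ^ N * u t) 0 = 0"
    using 0(3) by (simp add: extend_by_parity_def)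
  ultimately show ?case using e(1) by (intro exI[of _ e]) simp
next
  case (Suc k u N \<sigma>)
  define v where "v = (\<lambda>t. real N * t * u t + t\<^sup>2 * deriv u t)"
  have "3 \<le> N" using Suc.prems(3) by simp
  from DERIV_extend_power_mult[OF Suc.prems(1,2) this, of \<sigma>] obtain e where e: "e > 0"
    "\<And>t. t \<in> {-e<..<e} \<Longrightarrow> (extend_by_parity \<sigma> (\<lambda>t. t ^ N * u t) has_real_derivative
      extend_by_parity (- \<sigma>) (\<lambda>t. t ^ (N - 2) * v t) t) (at t)"
    unfolding v_def by blast
  have "(v \<longlongrightarrow> real N * 0 * 0 + 0) (at_right 0)"
    unfolding v_def by (intro tendsto_intros Suc.prems scaled_derivative_tendsto_zero)
  hence lim: "(v \<longlongrightarrow> 0) (at_right 0)" by simp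
  have v: "dfun v"
    unfolding v_def by (intro definability dfun_deriv Suc.prems)
  have "2 * k + 3 \<le> N - 2" using Suc.prems(3) by simp
  from Suc.IH[OF v lim this, of "- \<sigma>"] obtain d where d: "d > 0"
    "flat_C k {-d<..<d} {0} (extend_by_parity (- \<sigma>) (\<lambda>t. t ^ (N - 2) * v t))" by auto
  let ?e = "min d e"
  have C: "flat_C k {- ?e<..< ?e} {0} (extend_by_parity (- \<sigma>) (\<lambda>t. t ^ (N - 2) * v t))"
    by (rule flat_C_subset[OF d(2)]) auto
  have "flat_C (Suc k) {- ?e<..< ?e} {0} (extend_by_parity \<sigma> (\<lambda>t. t ^ N * u t))"
    using Suc.prems(3) by (intro flat_C_SucI[OF _ e(2) C]) (auto simp: extend_by_parity_def)
  thus ?case using d(1) e(1) by (intro exI[of _ ?e]) simp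
qed

end

section \<open>The minorant\<close>

lemma strict_mono_of_odd:
  fixes f :: "real \<Rightarrow> real"
  assumes odd: "\<And>t. f (- t) = - f t"
    and pos: "\<And>t. 0 < t \<Longrightarrow> 0 < f t" and incr: "\<And>s t. 0 < s \<Longrightarrow> s < t \<Longrightarrow> f s < f t"
  shows "strict_mono f"
proof (rule strict_monoI)
  fix s t :: real assume "s < t"
  have "f 0 = 0" using odd[of 0] by simp
  consider "0 < s" | "0 < t" "s \<le> 0" | "t \<le> 0" by linarith
  thus "f s < f t"
  proof cases
    case 1
    thus ?thesis using incr \<open>s < t\<close> by simp
  next
    case 2
    hence "f s \<le> 0" using pos[of "- s"] odd[of s] \<open>f 0 = 0\<close> by (cases "s = 0") auto
    thus ?thesis using pos[OF 2(1)] by simp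
  next
    case 3
    thus ?thesis
      using pos[of "- s"] incr[of "- t" "- s"] odd[of s] odd[of t] \<open>s < t\<close> \<open>f 0 = 0\<close>
      by (cases "t = 0") auto
  qed
qed

lemma divide_sqrt_strict_mono:
  fixes s t :: real
  assumes "0 < s" "s < t"
  shows "s / sqrt (1 + s\<^sup>2) < t / sqrt (1 + t\<^sup>2)"
proof -
  have "s\<^sup>2 < t\<^sup>2" using assms by (simp add: power_strict_mono)
  moreover have pos: "0 < 1 + s\<^sup>2" "0 < 1 + t\<^sup>2" by (simp_all add: add_pos_nonneg)
  ultimately have "s\<^sup>2 / (1 + s\<^sup>2) < t\<^sup>2 / (1 + t\<^sup>2)" by (simp add: field_simps)
  hence "sqrt (s\<^sup>2 / (1 + s\<^sup>2)) < sqrt (t\<^sup>2 / (1 + t\<^sup>2))" by (rule real_sqrt_less_mono)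
  thus ?thesis using assms by (simp add: real_sqrt_divide)
qed

lemma abs_divide_sqrt_less_1: "\<bar>t / sqrt (1 + t\<^sup>2)\<bar> < (1 :: real)"
proof -
  have "sqrt (t\<^sup>2) < sqrt (1 + t\<^sup>2)" by (intro real_sqrt_less_mono) simp
  moreover have "0 < sqrt (1 + t\<^sup>2)" by (simp add: add_pos_nonneg)
  ultimately show ?thesis by (simp add: abs_divide)
qed

text \<open>The odd extension of \<open>t ^ (2 * p + 4) * m t\<close> is flat at zero but smooth only near zero;
  composing it with a contraction of the line into a small interval preserves the bound by the
  monotone \<open>m\<close>, and the factor \<open>1 + t\<^sup>2\<close> restores unboundedness.\<close>

lemma (in o_minimal_structure) definable_minorant_in_Phi:
  fixes m :: "real \<Rightarrow> real"
  assumes m: "dfun m" and pos: "\<And>t. 0 < t \<Longrightarrow> 0 < m t" and le1: "\<And>t. 0 < t \<Longrightarrow> m t \<le> 1"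
    and mono: "\<And>s t. 0 < s \<Longrightarrow> s \<le> t \<Longrightarrow> m s \<le> m t"
  obtains \<phi> where "\<phi> \<in> Phi p" "dfun \<phi>" "\<And>t. 0 < t \<Longrightarrow> t \<le> T \<Longrightarrow> \<phi> t \<le> m t"
proof -
  \<comment> \<open>\<open>N\<close> is the least exponent that \<open>flat_C_power_mult\<close>
    accepts for order \<open>p\<close>. Since \<open>m\<close> may have a positive limit at zero,
    the extra factor \<open>t\<close> in \<open>h\<close> provides a function tending to
    zero.\<close>
  define N where "N = 2 * p + 3"
  define h where "h = (\<lambda>t. t ^ N * (t * m t))"
  define f where "f = extend_by_parity (- 1) h"
  have lim: "((\<lambda>t. t * m t) \<longlongrightarrow> 0) (at_right 0)"
  proof (rule tendsto_sandwich[of "\<lambda>t. 0" _ _ "\<lambda>t. t"])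
    show "\<forall>\<^sub>F t in at_right 0. 0 \<le> t * m t" "\<forall>\<^sub>F t in at_right 0. t * m t \<le> t"
      using pos le1 by (auto simp: eventually_at_filter less_imp_le mult_le_cancel_left2)
  qed (auto intro!: tendsto_intros)
  have u: "dfun (\<lambda>t. t * m t)" by (intro definability m)
  obtain e0 where e0: "e0 > 0" "flat_C p {-e0<..<e0} {0} f"
    using flat_C_power_mult[OF u lim, of p N "- 1"] by (auto simp: N_def h_def f_def)
  \<comment> \<open>\<open>e \<le> 1\<close> gives both \<open>h s \<le> m s\<close> for positive
    values \<open>s\<close> of \<open>r\<close>, and \<open>r t \<le> t\<close> for positive
    \<open>t\<close>.\<close>
  define e where "e = min e0 1"
  have e: "0 < e" "e \<le> 1" using e0(1) by (auto simp: e_def)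
  define r where "r = (\<lambda>t :: real. e * (t * (1 / sqrt (1 + t\<^sup>2))))"
  \<comment> \<open>The divisor \<open>1 + T\<^sup>2\<close> makes the growth factor at most
    \<open>1\<close> for \<open>0 < t \<le> T\<close>.\<close>
  define \<phi> where "\<phi> = (\<lambda>t. f (r t) * ((1 + t * t) * (1 / (1 + T\<^sup>2))))"
  have T: "1 + T\<^sup>2 > 0" by (simp add: add_pos_nonneg)
  have r_odd: "r (- t) = - r t" for t by (simp add: r_def)
  have r_pos: "0 < r t" if "0 < t" for t
    using e that by (simp add: r_def add_pos_nonneg)
  have r_less: "\<bar>r t\<bar> < e" for t
    using mult_strict_left_mono[OF abs_divide_sqrt_less_1[of t] e(1)] e by (simp add: r_def abs_mult)
  have r_mono: "r s < r t" if "0 < s" "s < t" for s t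
    using mult_strict_left_mono[OF divide_sqrt_strict_mono[OF that] e(1)] by (simp add: r_def)
  have r_le: "r t \<le> t" if "0 < t" for t
  proof -
    have "1 \<le> sqrt (1 + t\<^sup>2)" by simp
    hence "1 / sqrt (1 + t\<^sup>2) \<le> 1" using frac_le[of 1 1 1 "sqrt (1 + t\<^sup>2)"] by simp
    hence "e * (t * (1 / sqrt (1 + t\<^sup>2))) \<le> 1 * (t * 1)"
      using e that by (intro mult_mono) (auto intro: mult_left_le)
    thus ?thesis by (simp add: r_def)
  qed
  have h_pos: "0 < h t" if "0 < t" for t using pos that by (simp add: h_def)
  have h_mono: "h s < h t" if "0 < s" "s < t" for s t
    unfolding h_def
  proof (rule mult_strict_mono)
    show "s ^ N < t ^ N" using that by (intro power_strict_mono) (auto simp: N_def)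
    show "s * m s < t * m t"
      using that pos[of s] mono[of s t] by (intro mult_less_le_imp_less) auto
  qed (use that pos[of s] in auto)
  have h_le: "h t \<le> m t" if "0 < t" "t \<le> 1" for t
  proof -
    have "t ^ N * t \<le> 1" using that by (intro mult_le_one power_le_one) auto
    thus ?thesis using mult_right_mono[of "t ^ N * t" 1 "m t"] pos[of t] that by (simp add: h_def)
  qed
  have f_pos: "f t = h t" if "0 < t" for t using that by (simp add: f_def extend_by_parity_def)
  have f_odd: "f (- t) = - f t" for t
    unfolding f_def by (rule extend_by_parity_odd) (simp add: h_def)
  have \<phi>_odd: "\<phi> (- t) = - \<phi> t" for t by (simp add: \<phi>_def r_odd f_odd)
  have \<phi>_pos: "0 < \<phi> t" if "0 < t" for t
    using f_pos h_pos r_pos that T by (auto simp: \<phi>_def add_pos_nonneg intro!: mult_pos_pos divide_pos_pos)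
  have \<phi>_mono: "\<phi> s < \<phi> t" if st: "0 < s" "s < t" for s t
    unfolding \<phi>_def
  proof (rule mult_strict_mono)
    show "f (r s) < f (r t)" using f_pos h_mono r_pos r_mono st by simp
    have "1 + s * s < 1 + t * t" using st by (simp add: mult_strict_mono)
    thus "(1 + s * s) * (1 / (1 + T\<^sup>2)) < (1 + t * t) * (1 / (1 + T\<^sup>2))"
      using T by (intro mult_strict_right_mono) auto
    show "0 < f (r t)" using st f_pos h_pos r_pos by simp
  qed (use T in simp)
  have "flat_C p UNIV {0} \<phi>"
    unfolding \<phi>_def
  proof (intro flat_C_mult flat_C_compose[OF e0(2)] flat_C_const flat_C_add flat_C_id)
    show "flat_C p UNIV {} r"
      unfolding r_def by (intro flat_C_mult flat_C_const flat_C_id flat_C_inverse_sqrt)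
    show "r ` UNIV \<subseteq> {- e0<..<e0}"
    proof safe
      fix t show "r t \<in> {- e0<..<e0}" using r_less[of t] by (auto simp: e_def)
    qed
  qed (auto simp: r_def)
  moreover have "strict_mono \<phi>" by (rule strict_mono_of_odd[of \<phi>, OF \<phi>_odd \<phi>_pos \<phi>_mono])
  moreover have "\<exists>t. y \<le> \<phi> t" for y
  proof -
    \<comment> \<open>For \<open>t \<ge> 1\<close>, monotonicity and
      \<open>t \<le> 1 + t * t\<close> give \<open>c * t \<le> \<phi> t\<close>, so it is enough
      that \<open>t\<close> is also at least \<open>y / c\<close>.\<close>
    define c where "c = f (r 1) / (1 + T\<^sup>2)"
    have c: "c > 0" using f_pos[OF r_pos] h_pos[OF r_pos] T by (simp add: c_def)
    define t where "t = max 1 (y / c)"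
    have t: "1 \<le> t" by (simp add: t_def)
    hence "r 1 \<le> r t" using r_mono[of 1 t] by (cases "t = 1") auto
    hence "f (r 1) \<le> f (r t)"
      using f_pos[OF r_pos] h_mono[of "r 1" "r t"] r_pos t by (cases "r 1 = r t") auto
    moreover have "0 \<le> f (r 1)" using f_pos[OF r_pos] h_pos[OF r_pos] by (simp add: less_imp_le)
    moreover have "t \<le> 1 + t * t" using mult_right_mono[OF t, of t] t by linarith
    ultimately have "f (r 1) * (t * (1 / (1 + T\<^sup>2))) \<le> \<phi> t"
      unfolding \<phi>_def using T t by (intro mult_mono) auto
    moreover have "y \<le> c * t" using c by (auto simp: t_def field_simps max_def)
    ultimately show ?thesis by (intro exI[of _ t]) (simp add: c_def)
  qed
  ultimately have "\<phi> \<in> Phi p" using flat_C_imp_Phi \<phi>_odd by blast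
  moreover have "dfun \<phi>"
    unfolding \<phi>_def f_def extend_by_parity_def r_def h_def
    by (intro definability dfun_compose[OF m])
  moreover have "\<phi> t \<le> m t" if t: "0 < t" "t \<le> T" for t
  proof -
    have "t * t \<le> T * T" using t by (intro mult_mono) auto
    hence "(1 + t * t) * (1 / (1 + T\<^sup>2)) \<le> 1" using T by (simp add: power2_eq_square)
    moreover have "f (r t) \<le> m (r t)"
      using f_pos[OF r_pos] h_le[OF r_pos] r_less[of t] e(2) t by auto
    ultimately have "\<phi> t \<le> m (r t) * 1"
      unfolding \<phi>_def using pos[OF r_pos[OF t(1)]] T by (intro mult_mono) auto
    also have "\<dots> \<le> m t" using mono r_pos r_le t by simp
    finally show ?thesis .
  qed
  ultimately show ?thesis by (rule that)
qed

text \<open>Without a positive bound, points \<open>x n\<close> of \<open>K\<close> far from the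
  lower preimage would have values ever closer to \<open>B\<close>. A limit \<open>b\<close> of a
  subsequence is also outside the lower preimage, so some \<open>y \<in> F b\<close> misses
  \<open>B\<close>. Inner semi-continuity approximates \<open>y\<close> by points of the values
  along the subsequence, which forces \<open>y\<close> into the closed set \<open>B\<close>.\<close>

lemma inner_semicontinuous_excess_bounded_below:
  fixes F :: "'a::metric_space \<Rightarrow> 'b::metric_space set"
  assumes F: "inner_semicontinuous F" and B: "closed B" and K: "compact K" "K \<subseteq> mdom F"
    and t: "0 < t"
  shows "\<exists>s>0. \<forall>x\<in>K. (\<forall>l\<in>lower_preimage F B. t \<le> dist x l) \<longrightarrow> (\<exists>y\<in>F x. \<forall>w\<in>B. s \<le> dist y w)"
proof (rule ccontr)
  assume "\<not> ?thesis"
  hence neg: "\<not> (\<forall>x\<in>K. (\<forall>l\<in>lower_preimage F B. t \<le> dist x l) \<longrightarrow> (\<exists>y\<in>F x. \<forall>w\<in>B. s \<le> dist y w))"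
    if "s > 0" for s
    using that by blast
  have "\<forall>n. \<exists>x. x \<in> K \<and> (\<forall>l\<in>lower_preimage F B. t \<le> dist x l) \<and>
      (\<forall>y\<in>F x. \<exists>w\<in>B. dist y w < inverse (real (Suc n)))"
  proof
    fix n
    show "\<exists>x. x \<in> K \<and> (\<forall>l\<in>lower_preimage F B. t \<le> dist x l) \<and>
        (\<forall>y\<in>F x. \<exists>w\<in>B. dist y w < inverse (real (Suc n)))"
      using neg[of "inverse (real (Suc n))"] by (auto simp: not_le)
  qed
  from choice[OF this] obtain x where x: "\<And>n. x n \<in> K"
    "\<And>n l. l \<in> lower_preimage F B \<Longrightarrow> t \<le> dist (x n) l"
    "\<And>n y. y \<in> F (x n) \<Longrightarrow> \<exists>w\<in>B. dist y w < inverse (real (Suc n))"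
    by blast
  obtain b \<rho> where b: "b \<in> K" "strict_mono (\<rho> :: nat \<Rightarrow> nat)" "(x \<circ> \<rho>) \<longlonglongrightarrow> b"
    using K(1) x(1) unfolding compact_eq_seq_compact_metric seq_compact_def by metis
  have small: "infdist y B < inverse (real (Suc n))" if "y \<in> F (x n)" for y n
    using x(3)[OF that] infdist_le order_le_less_trans by blast
  have "t \<le> dist b l" if l: "l \<in> lower_preimage F B" for l
  proof (rule LIMSEQ_le_const)
    show "(\<lambda>n. dist ((x \<circ> \<rho>) n) l) \<longlonglongrightarrow> dist b l" by (intro tendsto_intros b(3))
  qed (use x(2)[OF l] in auto)
  hence "b \<notin> lower_preimage F B" using t by force
  then obtain y where y: "y \<in> F b" "y \<notin> B" using b(1) K(2) by (auto simp: lower_preimage_def)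
  \<comment> \<open>\<open>infdist\<close> to the empty set is \<open>0\<close> by convention, so
    nonemptiness has to be known before \<open>infdist y B\<close> can be shown positive.\<close>
  have "B \<noteq> {}"
  proof -
    obtain y0 where "y0 \<in> F (x 0)" using x(1)[of 0] K(2) by (auto simp: mdom_def)
    from x(3)[OF this] show ?thesis by blast
  qed
  hence \<eta>: "0 < infdist y B" using infdist_pos_not_in_closed[OF B _ y(2)] by simp
  \<comment> \<open>The lower limit only admits sequences avoiding \<open>b\<close>. From index
    \<open>M\<close> on the values lie closer to \<open>B\<close> than \<open>y \<in> F b\<close>
    does, so \<open>b\<close> itself cannot occur.\<close>
  then obtain M where M: "inverse (real (Suc M)) < infdist y B" using reals_Archimedean by blast
  define x' where "x' = (\<lambda>n. x (\<rho> (n + M)))"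
  have ge: "n + M \<le> \<rho> (n + M)" for n using b(2) by (rule seq_suble)
  have "x' n \<noteq> b" for n
  proof
    assume "x' n = b"
    hence "infdist y B < inverse (real (Suc (\<rho> (n + M))))" using small y(1) by (simp add: x'_def)
    also have "\<dots> \<le> inverse (real (Suc M))" using ge[of n] by (intro le_imp_inverse_le) auto
    finally show False using M by simp
  qed
  hence "\<forall>n. x' n \<in> mdom F - {b}" using x(1) K(2) by (auto simp: x'_def)
  moreover have "x' \<longlonglongrightarrow> b" using LIMSEQ_ignore_initial_segment[OF b(3), of M] by (simp add: x'_def)
  moreover have "y \<in> lower_limit F b"
    using F y(1) b(1) K(2) by (auto simp: inner_semicontinuous_def)
  ultimately obtain z where z: "\<And>n. z n \<in> F (x' n)" "z \<longlonglongrightarrow> y"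
    unfolding lower_limit_def by blast
  have "infdist y B \<le> 0"
  proof (rule LIMSEQ_le)
    show "(\<lambda>n. infdist (z n) B) \<longlonglongrightarrow> infdist y B" by (rule tendsto_infdist[OF z(2)])
    show "(\<lambda>n. inverse (real (Suc n))) \<longlonglongrightarrow> 0" by (rule LIMSEQ_inverse_real_of_nat)
    have "infdist (z n) B \<le> inverse (real (Suc n))" for n
    proof -
      have "infdist (z n) B < inverse (real (Suc (\<rho> (n + M))))"
        using small z(1)[of n] by (simp add: x'_def)
      also have "\<dots> \<le> inverse (real (Suc n))" using ge[of n] by (intro le_imp_inverse_le) auto
      finally show ?thesis by simp
    qed
    thus "\<exists>N. \<forall>n\<ge>N. infdist (z n) B \<le> inverse (real (Suc n))" by blast
  qed
  thus False using \<eta> by simp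
qed

section \<open>The Hausdorff distance and the conclusion\<close>

lemma bdd_above_infdist_image:
  assumes "compact A"
  shows "bdd_above ((\<lambda>x. infdist x B) ` A)"
  by (intro bounded_imp_bdd_above compact_imp_bounded compact_continuous_image
      continuous_intros assms)

text \<open>Compactness of \<open>A\<close> bounds the distances to \<open>B\<close>, so their real
  supremum dominates the distance of the single point \<open>y\<close>.\<close>

lemma hausdorff_dist_ge:
  assumes "compact A" "B \<noteq> {}" "y \<in> A" "\<And>w. w \<in> B \<Longrightarrow> s \<le> dist y w"
  shows "s \<le> hausdorff_dist A B"
proof -
  have "s \<le> infdist y B"
    using assms(2,4) by (auto simp: infdist_notempty intro: cINF_greatest)
  also have "\<dots> \<le> (SUP x\<in>A. infdist x B)"
    by (intro cSUP_upper assms bdd_above_infdist_image)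
  finally show ?thesis by (simp add: hausdorff_dist_def)
qed

theorem theorem5p15:
  fixes S :: "nat \<Rightarrow> real list set set"
    and F :: "real ^ 'm \<Rightarrow> (real ^ 'n) set"
    and a :: "real ^ 'm"
    and p :: nat
  assumes "o_minimal_structure S"
    and "p \<ge> 1"
    and "definable_multifunction S F"
    and "inner_semicontinuous F"
    and "\<And>x. compact (F x)"
    and "a \<in> mdom F"
  shows "\<forall>K. compact K \<and> a \<in> interior K \<and> K \<subseteq> mdom F \<and> definable S K \<longrightarrow>
    (\<exists>\<phi>\<in>Phi p. definable_fun S \<phi> \<and>
      (\<forall>x\<in>K. hausdorff_dist (F x) (F a) \<ge> \<phi> (infdist x (lower_preimage F (F a)))))"
proof (intro allI impI)
  fix K assume K: "compact K \<and> a \<in> interior K \<and> K \<subseteq> mdom F \<and> definable S K"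
  interpret o_minimal_structure S by fact
  define L where "L = lower_preimage F (F a)"
  \<comment> \<open>\<open>a \<in> L\<close> makes \<open>L\<close> nonempty and gives
    \<open>infdist x L \<le> dist x a\<close>.\<close>
  have a: "a \<in> L" "F a \<noteq> {}" using assms(6) by (auto simp: L_def lower_preimage_def mdom_def)
  \<comment> \<open>\<open>m\<close> is expressed as a supremum of admissible thresholds
    \<open>s\<close>, with the distances to \<open>L\<close> and \<open>F a\<close> written by
    quantifiers, so that its definability can be read off. The bound \<open>s \<le> 1\<close> keeps
    the supremum finite even if no point of \<open>K\<close> is that far from
    \<open>L\<close>.\<close>
  define R where "R = (\<lambda>t s. s \<le> 1 \<and> (\<forall>x. x \<in> K \<longrightarrow> (\<forall>l. l \<in> L \<longrightarrow> t \<le> dist x l) \<longrightarrow>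
    (\<exists>y. y \<in> F x \<and> (\<forall>w. w \<in> F a \<longrightarrow> s \<le> dist y w))))"
  define m where "m t = Sup {s. R t s}" for t
  \<comment> \<open>The threshold \<open>0\<close> is always admissible, as \<open>F x\<close> is
    nonempty on \<open>K\<close>.\<close>
  have R0: "R t 0" for t using K by (auto simp: R_def mdom_def)
  hence ex: "\<exists>s. R t s" for t by blast
  have bdd: "bdd_above {s. R t s}" for t by (auto simp: R_def intro!: bdd_aboveI[of _ 1])
  have R_le: "s \<le> m t" if "R t s" for s t
    unfolding m_def using that bdd by (intro cSup_upper) auto
  have "dfun m"
    unfolding m_def
  proof (rule dfun_Sup[OF _ ex bdd])
    have K_def: "dpred (\<lambda>x. x \<in> K)" using K by (simp add: dpred_def)
    have "dpred (\<lambda>z. snd z \<in> F (fst z))"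
      using assms(3) by (simp add: dpred_def definable_multifunction_def case_prod_unfold)
    note F_mem = dpred_compose2[of "\<lambda>x y. y \<in> F x", OF this]
    have "dpred (\<lambda>x. (\<exists>y. y \<in> F x) \<and> (\<forall>y. y \<in> F x \<longrightarrow> y \<in> F a))"
      by (intro definability F_mem)
    moreover have "((\<exists>y. y \<in> F x) \<and> (\<forall>y. y \<in> F x \<longrightarrow> y \<in> F a)) \<longleftrightarrow> x \<in> L" for x
      by (auto simp: L_def lower_preimage_def mdom_def)
    ultimately have L_def: "dpred (\<lambda>x. x \<in> L)" by simp
    show "dpred (\<lambda>z. R (fst z) (snd z))"
      unfolding R_def
      by (intro definability dpred_compose[OF K_def] dpred_compose[OF L_def] F_mem)
  qed
  moreover have "0 < m t" if t: "0 < t" for t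
  proof -
    obtain s where s: "s > 0"
      "\<forall>x\<in>K. (\<forall>l\<in>L. t \<le> dist x l) \<longrightarrow> (\<exists>y\<in>F x. \<forall>w\<in>F a. s \<le> dist y w)"
      using inner_semicontinuous_excess_bounded_below[OF assms(4) compact_imp_closed[OF assms(5)], of K t a]
        K t unfolding L_def by blast
    have "R t (min s 1)"
      unfolding R_def
    proof (intro conjI allI impI)
      fix x assume "x \<in> K" "\<forall>l. l \<in> L \<longrightarrow> t \<le> dist x l"
      with s(2) obtain y where "y \<in> F x" "\<forall>w\<in>F a. s \<le> dist y w" by blast
      thus "\<exists>y. y \<in> F x \<and> (\<forall>w. w \<in> F a \<longrightarrow> min s 1 \<le> dist y w)"
        by (intro exI[of _ y]) (auto simp: min.coboundedI1)
    qed simp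
    from R_le[OF this] show ?thesis using s(1) by simp
  qed
  moreover have "m t \<le> 1" for t
    unfolding m_def by (rule cSup_least) (use ex in blast, simp add: R_def)
  moreover have "m s \<le> m t" if "s \<le> t" for s t
  proof -
    have "R t u" if "R s u" for u
      using that \<open>s \<le> t\<close> unfolding R_def by (meson order_trans)
    thus ?thesis unfolding m_def using ex bdd by (intro cSup_subset_mono) auto
  qed
  \<comment> \<open>On \<open>K\<close> the distance to \<open>L\<close> is at most that to
    \<open>a\<close>, so a minorant on \<open>(0, T]\<close> suffices.\<close>
  moreover obtain T where T: "\<And>x. x \<in> K \<Longrightarrow> dist a x \<le> T"
    using compact_imp_bounded[of K] K bounded_any_center[of K a] by blast
  ultimately obtain \<phi> where \<phi>: "\<phi> \<in> Phi p" "dfun \<phi>" "\<And>t. 0 < t \<Longrightarrow> t \<le> T \<Longrightarrow> \<phi> t \<le> m t"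
    using definable_minorant_in_Phi[of m p T] by metis
  have "\<phi> (infdist x L) \<le> hausdorff_dist (F x) (F a)" if x: "x \<in> K" for x
  \<comment> \<open>On the closure of \<open>L\<close> the claim reduces to
    \<open>\<phi> 0 = 0\<close> and nonnegativity of the Hausdorff distance.\<close>
  proof (cases "infdist x L = 0")
    case True
    have "\<phi> (- 0) = - \<phi> 0" using \<phi>(1) unfolding Phi_def by blast
    hence "\<phi> 0 = 0" by simp
    obtain y where "y \<in> F x" using x K by (auto simp: mdom_def)
    from hausdorff_dist_ge[OF assms(5) a(2) this, of 0] show ?thesis
      using True \<open>\<phi> 0 = 0\<close> by simp
  next
    case False
    hence pos: "0 < infdist x L" using infdist_nonneg[of x L] by linarith
    have "infdist x L \<le> T"
      using infdist_le[OF a(1), of x] T[OF x] by (simp add: dist_commute)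
    from \<phi>(3)[OF pos this] have "\<phi> (infdist x L) \<le> m (infdist x L)" .
    also have "\<dots> \<le> hausdorff_dist (F x) (F a)"
      unfolding m_def
    proof (rule cSup_least)
      fix s assume "s \<in> {s. R (infdist x L) s}"
      hence "(\<forall>l. l \<in> L \<longrightarrow> infdist x L \<le> dist x l) \<longrightarrow>
          (\<exists>y. y \<in> F x \<and> (\<forall>w. w \<in> F a \<longrightarrow> s \<le> dist y w))"
        using x by (simp add: R_def)
      \<comment> \<open>\<open>x\<close> itself has distance at least \<open>infdist x L\<close>
        from every point of \<open>L\<close>, so each admissible threshold is realised by some
        \<open>y \<in> F x\<close>.\<close>
      then obtain y where "y \<in> F x" "\<forall>w. w \<in> F a \<longrightarrow> s \<le> dist y w"
        using infdist_le by blast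
      thus "s \<le> hausdorff_dist (F x) (F a)"
        by (intro hausdorff_dist_ge[OF assms(5) a(2)]) auto
    qed (use ex in blast)
    finally show ?thesis .
  qed
  thus "\<exists>\<phi>\<in>Phi p. definable_fun S \<phi> \<and>
      (\<forall>x\<in>K. hausdorff_dist (F x) (F a) \<ge> \<phi> (infdist x (lower_preimage F (F a))))"
    using \<phi>(1,2) by (auto simp: L_def dfun_iff)
qed

end
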